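(* Let $G$ be a discrete group, let $1<p<\infty$, and let $\mathcal{A}$ be a weak*-closed subalgebra of $\mathcal{B}(\ell^p(G))$ with $$PM_p(G) \subset \mathcal{A} \subset CV_p(G).$$ Then $\mathcal{A}$ is weak*-simple if and only if $G$ is ICC.
   Context: All Banach spaces are complex. $\mathcal B(\ell^p(G))$ is the algebra of bounded linear operators on $\ell^p(G)$, with the weak*-topology from $\mathcal B(\ell^p(G))=(\ell^{p'}(G)\widehat{\otimes}\ell^p(G))^*$ ($1/p+1/p'=1$, $\widehat\otimes$ the projective tensor product), duality $\langle \sum_j \eta_j\otimes \xi_j, T\rangle=\sum_j\langle \eta_j,T\xi_j\rangle$. Subalgebras carry the restricted weak*-topology. $\lambda_p$ and $\rho_p$ are the left and right regular representations of $G$ on $\ell^p(G)$: $(\lambda_p(t)\xi)(s)=\xi(t^{-1}s)$, $(\rho_p(t)\xi)(s)=\xi(st)$. $CV_p(G)=\{T\in \mathcal B(\ell^p(G)) : T\rho_p(t)=\rho_p(t)T \ (t\in G)\}$, and $PM_p(G)$ is the weak*-closed linear span of $\lambda_p(G)$ in $\mathcal B(\ell^p(G))$. "Ideal" means two-sided ideal. $\mathcal A$ is weak*-simple if it has no proper, non-zero, weak*-closed ideals. $G$ is ICC if every conjugacy class other than $\{e\}$ is infinite. *)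

theory Defs
  imports "HOL-Analysis.Analysis" "HOL-Algebra.Group" "HOL-Library.Function_Algebras"
begin

text \<open>
  Vectors of \<open>\<ell>\<^sup>p(I)\<close> are functions vanishing outside \<open>I\<close>, and operators on \<open>\<ell>\<^sup>p(I)\<close> are functions
  vanishing outside \<open>\<ell>\<^sup>p(I)\<close>; hence equality of vectors and of operators is equality of functions,
  and addition is the pointwise addition of \<open>Function_Algebras\<close>.
\<close>

definition ell :: "real \<Rightarrow> 'a set \<Rightarrow> ('a \<Rightarrow> complex) set" where
  "ell p I = {\<xi>. (\<forall>s. s \<notin> I \<longrightarrow> \<xi> s = 0) \<and> (\<lambda>s. norm (\<xi> s) powr p) summable_on I}"

definition ell_norm :: "real \<Rightarrow> 'a set \<Rightarrow> ('a \<Rightarrow> complex) \<Rightarrow> real" where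
  "ell_norm p I \<xi> = (\<Sum>\<^sub>\<infinity>s\<in>I. norm (\<xi> s) powr p) powr (1 / p)"

definition conj_exponent :: "real \<Rightarrow> real" where
  "conj_exponent p = p / (p - 1)"

lemma conj_exponent_eq: "1 < p \<Longrightarrow> 1 / p + 1 / conj_exponent p = 1"
  by (simp add: conj_exponent_def field_simps)

text \<open>The pairing of \<open>\<ell>\<^sup>p\<^sup>'(I)\<close> with \<open>\<ell>\<^sup>p(I)\<close> is bilinear (no complex conjugation).\<close>

definition ell_pairing :: "'a set \<Rightarrow> ('a \<Rightarrow> complex) \<Rightarrow> ('a \<Rightarrow> complex) \<Rightarrow> complex" where
  "ell_pairing I \<eta> \<xi> = (\<Sum>\<^sub>\<infinity>s\<in>I. \<eta> s * \<xi> s)"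

type_synonym 'a operator = "('a \<Rightarrow> complex) \<Rightarrow> ('a \<Rightarrow> complex)"

definition scale_vec :: "complex \<Rightarrow> ('a \<Rightarrow> complex) \<Rightarrow> ('a \<Rightarrow> complex)" where
  "scale_vec c \<xi> = (\<lambda>s. c * \<xi> s)"

definition scale_op :: "complex \<Rightarrow> 'a operator \<Rightarrow> 'a operator" where
  "scale_op c T = (\<lambda>\<xi>. scale_vec c (T \<xi>))"

interpretation opvs: vector_space scale_op
  by unfold_locales (auto simp: scale_op_def scale_vec_def fun_eq_iff algebra_simps)

definition bounded_ops :: "real \<Rightarrow> 'a set \<Rightarrow> 'a operator set" where
  "bounded_ops p I = {T.
     (\<forall>\<xi>. \<xi> \<notin> ell p I \<longrightarrow> T \<xi> = 0) \<and>
     (\<forall>\<xi>\<in>ell p I. T \<xi> \<in> ell p I) \<and>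
     (\<forall>\<xi>\<in>ell p I. \<forall>\<eta>\<in>ell p I. T (\<xi> + \<eta>) = T \<xi> + T \<eta>) \<and>
     (\<forall>c. \<forall>\<xi>\<in>ell p I. T (scale_vec c \<xi>) = scale_vec c (T \<xi>)) \<and>
     (\<exists>C. \<forall>\<xi>\<in>ell p I. ell_norm p I (T \<xi>) \<le> C * ell_norm p I \<xi>)}"

text \<open>
  The elements of the projective tensor product of \<open>\<ell>\<^sup>p\<^sup>'(I)\<close> and \<open>\<ell>\<^sup>p(I)\<close> are the sums
  \<open>\<Sum>\<^sub>j \<eta>\<^sub>j \<otimes> \<xi>\<^sub>j\<close> with \<open>\<Sum>\<^sub>j \<parallel>\<eta>\<^sub>j\<parallel> \<parallel>\<xi>\<^sub>j\<parallel> < \<infinity>\<close>. Different sequences may represent the same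
  tensor, but then they induce the same functional on operators, so the sequences may be used in
  place of the tensors to generate the weak*-topology.
\<close>

definition proj_tensors ::
    "real \<Rightarrow> 'a set \<Rightarrow> ((nat \<Rightarrow> 'a \<Rightarrow> complex) \<times> (nat \<Rightarrow> 'a \<Rightarrow> complex)) set" where
  "proj_tensors p I = {(\<eta>, \<xi>).
     (\<forall>j. \<eta> j \<in> ell (conj_exponent p) I) \<and> (\<forall>j. \<xi> j \<in> ell p I) \<and>
     summable (\<lambda>j. ell_norm (conj_exponent p) I (\<eta> j) * ell_norm p I (\<xi> j))}"

definition tensor_duality ::
    "'a set \<Rightarrow> (nat \<Rightarrow> 'a \<Rightarrow> complex) \<times> (nat \<Rightarrow> 'a \<Rightarrow> complex) \<Rightarrow> 'a operator \<Rightarrow> complex" where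
  "tensor_duality I u T = (\<Sum>j. ell_pairing I (fst u j) (T (snd u j)))"

definition weakstar_topology :: "real \<Rightarrow> 'a set \<Rightarrow> 'a operator topology" where
  "weakstar_topology p I = topology_generated_by
     {{T \<in> bounded_ops p I. tensor_duality I u T \<in> U} | u U. u \<in> proj_tensors p I \<and> open U}"

lemma ell_zero: "0 \<in> ell p I"
  by (simp add: ell_def)

lemma topspace_weakstar_topology [simp]: "topspace (weakstar_topology p I) = bounded_ops p I"
proof -
  have "((\<lambda>_. 0), (\<lambda>_. 0)) \<in> proj_tensors p I"
    by (simp add: proj_tensors_def ell_zero ell_norm_def)
  then have "bounded_ops p I \<in>
      {{T \<in> bounded_ops p I. tensor_duality I u T \<in> U} | u U. u \<in> proj_tensors p I \<and> open U}"
    by (intro CollectI exI[of _ "((\<lambda>_. 0), (\<lambda>_. 0))"] exI[of _ UNIV]) simp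
  then show ?thesis
    unfolding weakstar_topology_def topology_generated_by_topspace by blast
qed

text \<open>Algebras of operators need not contain the identity.\<close>

definition subalgebra :: "real \<Rightarrow> 'a set \<Rightarrow> 'a operator set \<Rightarrow> bool" where
  "subalgebra p I A \<longleftrightarrow>
     A \<subseteq> bounded_ops p I \<and> opvs.subspace A \<and> (\<forall>S\<in>A. \<forall>T\<in>A. S \<circ> T \<in> A)"

definition alg_ideal :: "'a operator set \<Rightarrow> 'a operator set \<Rightarrow> bool" where
  "alg_ideal A J \<longleftrightarrow>
     J \<subseteq> A \<and> opvs.subspace J \<and> (\<forall>S\<in>A. \<forall>T\<in>J. S \<circ> T \<in> J \<and> T \<circ> S \<in> J)"

definition weakstar_simple :: "real \<Rightarrow> 'a set \<Rightarrow> 'a operator set \<Rightarrow> bool" where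
  "weakstar_simple p I A \<longleftrightarrow>
     \<not> (\<exists>J. alg_ideal A J \<and> closedin (subtopology (weakstar_topology p I) A) J \<and>
            J \<noteq> {0} \<and> J \<noteq> A)"

definition left_regular :: "real \<Rightarrow> ('a, 'b) monoid_scheme \<Rightarrow> 'a \<Rightarrow> 'a operator" where
  "left_regular p G t = (\<lambda>\<xi> s. if \<xi> \<in> ell p (carrier G) \<and> s \<in> carrier G
     then \<xi> (inv\<^bsub>G\<^esub> t \<otimes>\<^bsub>G\<^esub> s) else 0)"

definition right_regular :: "real \<Rightarrow> ('a, 'b) monoid_scheme \<Rightarrow> 'a \<Rightarrow> 'a operator" where
  "right_regular p G t = (\<lambda>\<xi> s. if \<xi> \<in> ell p (carrier G) \<and> s \<in> carrier G
     then \<xi> (s \<otimes>\<^bsub>G\<^esub> t) else 0)"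

definition CV :: "real \<Rightarrow> ('a, 'b) monoid_scheme \<Rightarrow> 'a operator set" where
  "CV p G = {T \<in> bounded_ops p (carrier G).
     \<forall>t\<in>carrier G. T \<circ> right_regular p G t = right_regular p G t \<circ> T}"

definition PM :: "real \<Rightarrow> ('a, 'b) monoid_scheme \<Rightarrow> 'a operator set" where
  "PM p G = weakstar_topology p (carrier G) closure_of
     opvs.span (left_regular p G ` carrier G)"

definition conjugacy_class :: "('a, 'b) monoid_scheme \<Rightarrow> 'a \<Rightarrow> 'a set" where
  "conjugacy_class G x = {g \<otimes>\<^bsub>G\<^esub> x \<otimes>\<^bsub>G\<^esub> inv\<^bsub>G\<^esub> g | g. g \<in> carrier G}"

definition ICC :: "('a, 'b) monoid_scheme \<Rightarrow> bool" where
  "ICC G \<longleftrightarrow> (\<forall>x\<in>carrier G. conjugacy_class G x \<noteq> {\<one>\<^bsub>G\<^esub>} \<longrightarrow> infinite (conjugacy_class G x))"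

end

theory Submission
  imports Defs
begin

text \<open>An operator \<open>T\<close> that commutes with the right translations is determined by its symbol
  \<open>\<tau> = T (delta \<one>)\<close>, because \<open>T (delta r)\<close> is the right translate of \<open>\<tau>\<close> by \<open>r\<close>. Conjugating \<open>T\<close> by
  \<open>\<lambda>\<^sub>p(t)\<close> conjugates \<open>\<tau>\<close> by \<open>t\<close> and does not change the norm.

  Let \<open>G\<close> be ICC and let \<open>T \<noteq> 0\<close> lie in a weak*-closed ideal \<open>J\<close>. After a left translation and a
  scaling, \<open>\<tau> \<one> = 1\<close>. For every finite \<open>E\<close> some \<open>t\<close> conjugates all elements of \<open>E - {\<one>}\<close> out of \<open>E\<close>
  (\<open>ICC_escape\<close>). As \<open>\<tau>\<close> is large only on finite sets, the matrix entries of the conjugates of \<open>T\<close>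
  along these \<open>t\<close> tend to those of the identity. The conjugates are uniformly bounded, so they
  converge in the weak*-topology (\<open>limitin_weakstar_bounded\<close>), \<open>J\<close> contains the identity, and \<open>J\<close> is
  the whole algebra.

  If \<open>G\<close> is not ICC, there are a class function \<open>Q\<close> and a function \<open>F\<close>, both nonzero and in
  \<open>\<ell>\<^sup>1(G)\<close>, with \<open>Q \<star> F = 0\<close> (\<open>zero_divisor_if_not_ICC\<close>). Left convolution by a class function is also
  a right convolution, so it commutes with every operator in \<open>CV\<close>
  (\<open>CV_commutes_class_function\<close>). Hence the \<open>T\<close> in \<open>A\<close> with \<open>Q \<star> T \<xi> = 0\<close> for all \<open>\<xi>\<close> form a
  weak*-closed ideal. It contains the convolution by \<open>F\<close> but not the identity.

  To find \<open>Q\<close> and \<open>F\<close>, let \<open>x \<noteq> \<one>\<close> have a finite class \<open>C\<close>. If \<open>x\<close> has finite order, \<open>C\<close> generates a finite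
  subgroup \<open>H\<close> by Dietzmann's lemma, and the indicator of \<open>H\<close> is annihilated by
  \<open>card C * delta \<one>\<close> minus the indicator of \<open>C\<close>.

  If \<open>x\<close> has infinite order, some power \<open>y\<close> of \<open>x\<close> commutes with all of \<open>C\<close>, so its class \<open>D\<close> is finite
  and commutative. On the dual circle of the group generated by \<open>y\<close>, the function \<open>1 + z\<^sup>2\<close> has the two
  square roots \<open>a = (1 + z\<^sup>2)\<^bsup>1/2\<^esup>\<close> and \<open>b = z (1 + z\<^bsup>-2\<^esup>)\<^bsup>1/2\<^esup>\<close>, which coincide on one half of the circle
  and differ by a sign on the other. Their binomial series converge absolutely, so they define
  elements of \<open>\<ell>\<^sup>1(G)\<close>, and \<open>(a - b) \<star> (a + b) = 0\<close>. Let \<open>Q\<close> be the sum of the \<open>a - b\<close> over \<open>D\<close> and \<open>F\<close> the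
  product of the \<open>a + b\<close> over \<open>D\<close>. The value of \<open>Q\<close> at \<open>\<one>\<close> is \<open>card D\<close>, because \<open>b\<close> has odd powers only;
  \<open>F\<close> is nonzero because the sum of all coefficients is multiplicative and does not vanish on
  \<open>a + b\<close>.\<close>

section \<open>The spaces \<open>\<ell>\<^sup>p(I)\<close> and their bounded functionals\<close>

lemma conj_exponent_gt_1: "1 < p \<Longrightarrow> 1 < conj_exponent p"
  by (simp add: conj_exponent_def field_simps)

lemma conj_exponent_involutive: "1 < p \<Longrightarrow> conj_exponent (conj_exponent p) = p"
  by (simp add: conj_exponent_def field_simps)

lemma ell_summable: "\<xi> \<in> ell p I \<Longrightarrow> (\<lambda>s. norm (\<xi> s) powr p) summable_on I"
  by (simp add: ell_def)

lemma ell_outside: "\<xi> \<in> ell p I \<Longrightarrow> s \<notin> I \<Longrightarrow> \<xi> s = 0"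
  by (simp add: ell_def)

lemma ell_norm_nonneg [simp]: "0 \<le> ell_norm p I \<xi>"
  by (simp add: ell_norm_def)

lemma ell_norm_powr: "0 < p \<Longrightarrow> ell_norm p I \<xi> powr p = (\<Sum>\<^sub>\<infinity>s\<in>I. norm (\<xi> s) powr p)"
  by (simp add: ell_norm_def powr_powr infsum_nonneg)

lemma powr_le_powr_iff:
  fixes a b p :: real
  assumes "0 < p" "0 \<le> a" "0 \<le> b"
  shows "a powr p \<le> b powr p \<longleftrightarrow> a \<le> b"
  using assms powr_mono2[of p a b] powr_less_mono2[of p b a] by linarith

lemma ell_norm_le_iff:
  assumes "0 < p" "0 \<le> C"
  shows "ell_norm p I \<xi> \<le> C \<longleftrightarrow> (\<Sum>\<^sub>\<infinity>s\<in>I. norm (\<xi> s) powr p) \<le> C powr p"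
  unfolding ell_norm_powr[OF assms(1), symmetric] powr_le_powr_iff[OF assms(1) ell_norm_nonneg
      assms(2)] ..

lemma norm_le_ell_norm:
  assumes "0 < p" "\<xi> \<in> ell p I"
  shows "norm (\<xi> s) \<le> ell_norm p I \<xi>"
proof (cases "s \<in> I")
  case True
  have "norm (\<xi> s) powr p \<le> (\<Sum>\<^sub>\<infinity>s\<in>I. norm (\<xi> s) powr p)"
    using finite_sum_le_infsum[OF ell_summable[OF assms(2)], of "{s}"] True by simp
  then have "norm (\<xi> s) powr p \<le> ell_norm p I \<xi> powr p"
    by (simp add: ell_norm_powr assms)
  then show ?thesis
    using assms(1) by (simp add: powr_le_powr_iff)
qed (use assms in \<open>simp add: ell_outside\<close>)

lemma ell_dominated:
  assumes "0 < p" "\<xi> \<in> ell p I" "\<And>s. s \<in> I \<Longrightarrow> norm (\<zeta> s) \<le> norm (\<xi> s)"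
    and "\<And>s. s \<notin> I \<Longrightarrow> \<zeta> s = 0"
  shows "\<zeta> \<in> ell p I" "ell_norm p I \<zeta> \<le> ell_norm p I \<xi>"
proof -
  have le: "norm (\<zeta> s) powr p \<le> norm (\<xi> s) powr p" if "s \<in> I" for s
    using assms(1,3) that by (intro powr_mono2) auto
  have s: "(\<lambda>s. norm (\<zeta> s) powr p) summable_on I"
    by (rule summable_on_comparison_test[OF ell_summable[OF assms(2)]]) (use le in auto)
  then show "\<zeta> \<in> ell p I"
    using assms(4) by (simp add: ell_def)
  have "(\<Sum>\<^sub>\<infinity>s\<in>I. norm (\<zeta> s) powr p) \<le> (\<Sum>\<^sub>\<infinity>s\<in>I. norm (\<xi> s) powr p)"
    by (rule infsum_mono[OF s ell_summable[OF assms(2)]]) (use le in auto)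
  then show "ell_norm p I \<zeta> \<le> ell_norm p I \<xi>"
    unfolding ell_norm_def using assms(1) by (intro powr_mono2) (auto intro: infsum_nonneg)
qed

lemma ell_scale:
  assumes "0 < p" "\<xi> \<in> ell p I"
  shows "scale_vec c \<xi> \<in> ell p I" "ell_norm p I (scale_vec c \<xi>) = norm c * ell_norm p I \<xi>"
proof -
  have e: "norm (scale_vec c \<xi> s) powr p = norm c powr p * norm (\<xi> s) powr p" for s
    by (simp add: scale_vec_def norm_mult powr_mult)
  show "scale_vec c \<xi> \<in> ell p I"
    unfolding ell_def
    using assms(2) by (auto simp: e ell_def intro!: summable_on_cmult_right) (simp add: scale_vec_def)
  have "(\<Sum>\<^sub>\<infinity>s\<in>I. norm c powr p * norm (\<xi> s) powr p) = norm c powr p * (\<Sum>\<^sub>\<infinity>s\<in>I. norm (\<xi> s) powr p)"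
    by (rule infsum_cmult_right) (use assms in \<open>simp add: ell_summable\<close>)
  then show "ell_norm p I (scale_vec c \<xi>) = norm c * ell_norm p I \<xi>"
    unfolding ell_norm_def e using assms(1) by (simp add: powr_mult powr_powr infsum_nonneg)
qed

lemma ell_add:
  assumes "0 < p" "\<xi> \<in> ell p I" "\<eta> \<in> ell p I"
  shows "\<xi> + \<eta> \<in> ell p I"
proof -
  have "norm (\<xi> s + \<eta> s) powr p \<le> 2 powr p * (norm (\<xi> s) powr p + norm (\<eta> s) powr p)" for s
  proof -
    define m where "m = max (norm (\<xi> s)) (norm (\<eta> s))"
    have "norm (\<xi> s + \<eta> s) \<le> 2 * m"
      unfolding m_def using norm_triangle_ineq[of "\<xi> s" "\<eta> s"] by linarith
    then have "norm (\<xi> s + \<eta> s) powr p \<le> (2 * m) powr p"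
      using assms(1) by (intro powr_mono2) auto
    also have "\<dots> = 2 powr p * m powr p"
      by (simp add: powr_mult m_def)
    also have "m powr p \<le> norm (\<xi> s) powr p + norm (\<eta> s) powr p"
      unfolding m_def max_def by auto
    finally show ?thesis by simp
  qed
  then have "(\<lambda>s. norm ((\<xi> + \<eta>) s) powr p) summable_on I"
    by (intro summable_on_comparison_test[OF summable_on_cmult_right[OF summable_on_add[OF
          ell_summable[OF assms(2)] ell_summable[OF assms(3)]]]]) auto
  then show ?thesis
    using assms by (simp add: ell_def)
qed

lemma ell_diff:
  assumes "0 < p" "\<xi> \<in> ell p I" "\<eta> \<in> ell p I"
  shows "\<xi> - \<eta> \<in> ell p I"
proof -
  have "\<xi> - \<eta> = \<xi> + scale_vec (-1) \<eta>"
    by (auto simp: scale_vec_def)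
  then show ?thesis
    using ell_add[OF assms(1,2) ell_scale(1)[OF assms(1,3)]] by metis
qed

lemma ell_norm_0 [simp]: "ell_norm p I 0 = 0"
  by (simp add: ell_norm_def)

lemma ell_finite_support:
  assumes "finite E" "E \<subseteq> I" "\<And>s. s \<notin> E \<Longrightarrow> \<xi> s = 0"
  shows "\<xi> \<in> ell p I"
proof -
  have "finite {s \<in> I. norm (\<xi> s) powr p \<noteq> 0}"
    by (rule finite_subset[OF _ assms(1)]) (use assms(3) in auto)
  then show ?thesis
    using assms(2,3) by (auto simp: ell_def intro: finite_nonzero_values_imp_summable_on)
qed

lemma ell_1_subset_ell:
  assumes "1 \<le> p" "f \<in> ell 1 I"
  shows "f \<in> ell p I"
proof -
  define M where "M = ell_norm 1 I f"
  have "norm (f s) powr p \<le> M powr (p - 1) * (norm (f s) powr 1)" for s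
  proof -
    have "norm (f s) powr p = norm (f s) powr (p - 1) * norm (f s) powr 1"
      by (subst powr_add[symmetric]) simp
    moreover have "norm (f s) powr (p - 1) \<le> M powr (p - 1)"
      unfolding M_def using assms by (intro powr_mono2) (auto intro: norm_le_ell_norm)
    ultimately show ?thesis
      by (simp add: mult_right_mono)
  qed
  then have "(\<lambda>s. norm (f s) powr p) summable_on I"
    by (intro summable_on_comparison_test[OF summable_on_cmult_right[OF ell_summable[OF
        assms(2)]]]) auto
  then show ?thesis
    using assms by (simp add: ell_def)
qed

definition delta :: "'a \<Rightarrow> 'a \<Rightarrow> complex" where
  "delta r = (\<lambda>s. if s = r then 1 else 0)"

lemma delta_apply: "delta r s = (if s = r then 1 else 0)"
  by (simp add: delta_def)

lemma delta_in_ell [simp]: "r \<in> I \<Longrightarrow> delta r \<in> ell p I"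
  by (rule ell_finite_support[of "{r}"]) (auto simp: delta_def)

text \<open>The pointwise Young inequality, applied to the vectors scaled to norm 1, is summed over \<open>I\<close>.\<close>

theorem Holder_inequality_ell:
  assumes "1 < p" "\<eta> \<in> ell (conj_exponent p) I" "\<xi> \<in> ell p I"
  shows "(\<lambda>s. norm (\<eta> s * \<xi> s)) summable_on I"
    and "(\<Sum>\<^sub>\<infinity>s\<in>I. norm (\<eta> s * \<xi> s)) \<le> ell_norm (conj_exponent p) I \<eta> * ell_norm p I \<xi>"
proof -
  define q where "q = conj_exponent p"
  have pq: "1 < q" "1/p + 1/q = 1"
    using assms conj_exponent_gt_1 conj_exponent_eq by (auto simp: q_def)
  have \<eta>: "(\<lambda>s. norm (\<eta> s) powr q) summable_on I" and \<xi>: "(\<lambda>s. norm (\<xi> s) powr p) summable_on I"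
    using assms by (auto simp: q_def ell_summable)
  have Young: "norm (\<eta> s * \<xi> s) \<le> norm (\<xi> s) powr p / p + norm (\<eta> s) powr q / q" for s
    using Youngs_inequality[OF assms(1) pq, of "norm (\<xi> s)" "norm (\<eta> s)"]
    by (simp add: norm_mult mult.commute)
  show summ: "(\<lambda>s. norm (\<eta> s * \<xi> s)) summable_on I"
    by (rule Infinite_Sum.abs_summable_on_comparison_test'[of "\<lambda>s. norm (\<xi> s) powr p / p
        + norm (\<eta> s) powr q / q"])
       (use Young in \<open>auto intro!: summable_on_add \<eta> \<xi> summable_on_cmult_left simp: divide_inverse\<close>)
  define N M where "N = ell_norm q I \<eta>" and "M = ell_norm p I \<xi>"
  have "0 \<le> N" "0 \<le> M" by (auto simp: N_def M_def)
  show "(\<Sum>\<^sub>\<infinity>s\<in>I. norm (\<eta> s * \<xi> s)) \<le> ell_norm (conj_exponent p) I \<eta> * ell_norm p I \<xi>"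
  proof (cases "N = 0 \<or> M = 0")
    case True
    then have "\<eta> s = 0 \<or> \<xi> s = 0" for s
      using norm_le_ell_norm[of q \<eta> I s] norm_le_ell_norm[of p \<xi> I s] assms pq
      by (auto simp: N_def M_def q_def)
    then show ?thesis
      by (simp add: infsum_0)
  next
    case False
    then have pos: "0 < N" "0 < M"
      using \<open>0 \<le> N\<close> \<open>0 \<le> M\<close> by auto
    have le: "norm (\<eta> s * \<xi> s) \<le> N * M * (norm (\<xi> s) powr p * (1 / (p * M powr p))
        + norm (\<eta> s) powr q * (1 / (q * N powr q)))" for s
      using Youngs_inequality[OF assms(1) pq, of "norm (\<xi> s) / M" "norm (\<eta> s) / N"] pos
      by (simp add: norm_mult powr_divide field_simps)
    have "(\<Sum>\<^sub>\<infinity>s\<in>I. norm (\<eta> s * \<xi> s)) \<le> (\<Sum>\<^sub>\<infinity>s\<in>I. N * M * (norm (\<xi> s) powr p * (1 / (p * M powr p))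
        + norm (\<eta> s) powr q * (1 / (q * N powr q))))"
      by (rule infsum_mono[OF summ]) (use le in \<open>auto simp: divide_inverse
          intro!: summable_on_cmult_right summable_on_add summable_on_cmult_left \<eta> \<xi>\<close>)
    also have "\<dots> = N * M * ((\<Sum>\<^sub>\<infinity>s\<in>I. norm (\<xi> s) powr p) * (1 / (p * M powr p))
        + (\<Sum>\<^sub>\<infinity>s\<in>I. norm (\<eta> s) powr q) * (1 / (q * N powr q)))"
      by (subst infsum_cmult_right, (intro summable_on_add summable_on_cmult_left \<eta> \<xi>),
          subst infsum_add, (intro summable_on_cmult_left \<eta> \<xi>)+)
         (simp only: infsum_cmult_left[OF \<eta>] infsum_cmult_left[OF \<xi>])
    also have "\<dots> = N * M * (1/p + 1/q)"
      using assms(1) pq(1) pos by (simp add: N_def M_def ell_norm_powr[symmetric])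
    finally show ?thesis
      using pq by (simp add: N_def M_def q_def)
  qed
qed

lemma ell_pairing_commute: "ell_pairing I \<eta> \<xi> = ell_pairing I \<xi> \<eta>"
  by (simp add: ell_pairing_def mult.commute)

lemma ell_pairing_delta: "s \<in> I \<Longrightarrow> ell_pairing I (delta s) \<xi> = \<xi> s"
  unfolding ell_pairing_def
  by (subst infsum_cong_neutral[where T = "{s}" and g = \<xi>]) (auto simp: delta_def)

text \<open>The constant \<open>K\<close> is a parameter because nets of functionals with a common bound are needed.\<close>

definition ell_functional :: "real \<Rightarrow> 'a set \<Rightarrow> real \<Rightarrow> (('a \<Rightarrow> complex) \<Rightarrow> complex) \<Rightarrow> bool" where
  "ell_functional p I K \<phi> \<longleftrightarrow>
     (\<forall>\<xi>\<in>ell p I. \<forall>\<eta>\<in>ell p I. \<phi> (\<xi> + \<eta>) = \<phi> \<xi> + \<phi> \<eta>) \<and>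
     (\<forall>c. \<forall>\<xi>\<in>ell p I. \<phi> (scale_vec c \<xi>) = c * \<phi> \<xi>) \<and>
     (\<forall>\<xi>\<in>ell p I. norm (\<phi> \<xi>) \<le> K * ell_norm p I \<xi>)"

lemma ell_functional_pairing:
  assumes "1 < p" "\<eta> \<in> ell (conj_exponent p) I"
  shows "ell_functional p I (ell_norm (conj_exponent p) I \<eta>) (ell_pairing I \<eta>)"
  unfolding ell_functional_def
proof (intro conjI ballI allI)
  note H = Holder_inequality_ell[OF assms]
  fix \<xi> assume \<xi>: "\<xi> \<in> ell p I"
  note S = abs_summable_summable[OF H(1)]
  show "norm (ell_pairing I \<eta> \<xi>) \<le> ell_norm (conj_exponent p) I \<eta> * ell_norm p I \<xi>"
    unfolding ell_pairing_def using norm_infsum_bound[OF H(1)[OF \<xi>]] H(2)[OF \<xi>] by linarith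
  show "ell_pairing I \<eta> (scale_vec c \<xi>) = c * ell_pairing I \<eta> \<xi>" for c
    unfolding ell_pairing_def using infsum_cmult_right[OF S[OF \<xi>], of c]
    by (simp add: scale_vec_def algebra_simps)
  show "ell_pairing I \<eta> (\<xi> + \<zeta>) = ell_pairing I \<eta> \<xi> + ell_pairing I \<eta> \<zeta>" if "\<zeta> \<in> ell p I" for \<zeta>
    unfolding ell_pairing_def using infsum_add[OF S[OF \<xi>] S[OF that]]
    by (simp add: algebra_simps)
qed

definition cut_off :: "'a set \<Rightarrow> ('a \<Rightarrow> complex) \<Rightarrow> 'a \<Rightarrow> complex" where
  "cut_off E \<xi> = (\<lambda>s. if s \<in> E then \<xi> s else 0)"

lemma cut_off_in_ell: "0 < p \<Longrightarrow> \<xi> \<in> ell p I \<Longrightarrow> cut_off E \<xi> \<in> ell p I"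
  by (rule ell_dominated[of p \<xi>]) (auto simp: cut_off_def ell_outside)

text \<open>This is where \<open>p < \<infinity>\<close> enters: finitely supported vectors are dense, so a bounded functional is
  determined by its values on the \<open>delta r\<close>, and for a bounded net of functionals convergence can be
  tested there.\<close>

lemma ell_norm_tail_tendsto_0:
  assumes "0 < p" "\<xi> \<in> ell p I"
  shows "((\<lambda>E. ell_norm p I (\<xi> - cut_off E \<xi>)) \<longlongrightarrow> 0) (finite_subsets_at_top I)"
proof -
  let ?f = "\<lambda>s. norm (\<xi> s) powr p"
  have "((\<lambda>E. infsum ?f I - sum ?f E) \<longlongrightarrow> infsum ?f I - infsum ?f I) (finite_subsets_at_top I)"
    by (intro tendsto_intros infsum_tendsto ell_summable assms)
  then have lim: "((\<lambda>E. (infsum ?f I - sum ?f E) powr (1/p)) \<longlongrightarrow> 0 powr (1/p)) (finite_subsets_at_top I)"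
    using assms(1)
    by (intro tendsto_powr') (auto intro!: always_eventually eventually_finite_subsets_at_top_weakI
        finite_sum_le_infsum ell_summable assms)
  have eq: "ell_norm p I (\<xi> - cut_off E \<xi>) = (infsum ?f I - sum ?f E) powr (1/p)"
    if "finite E" "E \<subseteq> I" for E
  proof -
    have "infsum ?f I - sum ?f E = infsum ?f (I - E)"
      using infsum_Diff[of ?f I E] that ell_summable[OF assms(2)] by simp
    also have "\<dots> = (\<Sum>\<^sub>\<infinity>s\<in>I. norm ((\<xi> - cut_off E \<xi>) s) powr p)"
      by (rule infsum_cong_neutral) (auto simp: cut_off_def)
    finally show ?thesis
      by (simp add: ell_norm_def)
  qed
  have ev: "\<forall>\<^sub>F E in finite_subsets_at_top I.
      (infsum ?f I - sum ?f E) powr (1/p) = ell_norm p I (\<xi> - cut_off E \<xi>)"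
    by (intro eventually_finite_subsets_at_top_weakI) (simp add: eq)
  have "((\<lambda>E. ell_norm p I (\<xi> - cut_off E \<xi>)) \<longlongrightarrow> 0 powr (1/p)) (finite_subsets_at_top I)"
    by (rule Lim_transform_eventually[OF lim ev])
  then show ?thesis by simp
qed

lemma ell_finite_superlevel:
  assumes "0 < p" "\<xi> \<in> ell p I" "0 < e"
  shows "finite {s \<in> I. e \<le> norm (\<xi> s)}"
proof -
  have "\<forall>\<^sub>F E in finite_subsets_at_top I. ell_norm p I (\<xi> - cut_off E \<xi>) < e"
    using order_tendstoD(2)[OF ell_norm_tail_tendsto_0[OF assms(1,2)] assms(3)] .
  then obtain E where E: "finite E" "E \<subseteq> I" "ell_norm p I (\<xi> - cut_off E \<xi>) < e"
    unfolding eventually_finite_subsets_at_top by blast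
  have "s \<in> E" if "e \<le> norm (\<xi> s)" for s
  proof (rule ccontr)
    assume "s \<notin> E"
    then have "norm (\<xi> s) = norm ((\<xi> - cut_off E \<xi>) s)"
      by (simp add: cut_off_def)
    also have "\<dots> \<le> ell_norm p I (\<xi> - cut_off E \<xi>)"
      by (intro norm_le_ell_norm ell_diff cut_off_in_ell assms(1,2))
    finally show False
      using E(3) that by simp
  qed
  then show ?thesis
    by (intro finite_subset[OF _ E(1)]) blast
qed

lemma ell_functional_cut_off:
  assumes "0 < p" "ell_functional p I K \<phi>" "\<xi> \<in> ell p I" "finite E" "E \<subseteq> I"
  shows "\<phi> (cut_off E \<xi>) = (\<Sum>r\<in>E. \<xi> r * \<phi> (delta r))"
  using assms(4,5)
proof (induction E rule: finite_induct)
  case empty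
  have "norm (\<phi> 0) \<le> K * ell_norm p I 0"
    using assms(2) ell_zero unfolding ell_functional_def by blast
  then have "\<phi> 0 = 0" by simp
  moreover have "cut_off {} \<xi> = 0"
    by (auto simp: cut_off_def)
  ultimately show ?case by (simp del: zero_fun_apply add: zero_fun_def[symmetric])
next
  case (insert x E)
  have eq: "cut_off (insert x E) \<xi> = scale_vec (\<xi> x) (delta x) + cut_off E \<xi>"
    using insert.hyps by (auto simp: cut_off_def scale_vec_def delta_def)
  have x: "delta x \<in> ell p I"
    using insert.prems by simp
  have "\<phi> (cut_off (insert x E) \<xi>) = \<xi> x * \<phi> (delta x) + \<phi> (cut_off E \<xi>)"
    unfolding eq using assms(2) ell_scale(1)[OF assms(1) x] x cut_off_in_ell[OF assms(1,3)]
    unfolding ell_functional_def by metis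
  then show ?case
    using insert by simp
qed

lemma ell_functional_tail:
  assumes "0 < p" "ell_functional p I K \<phi>" "\<xi> \<in> ell p I"
  shows "norm (\<phi> \<xi> - \<phi> (cut_off E \<xi>)) \<le> K * ell_norm p I (\<xi> - cut_off E \<xi>)"
proof -
  have t: "cut_off E \<xi> \<in> ell p I" "\<xi> - cut_off E \<xi> \<in> ell p I"
    using assms by (auto intro: cut_off_in_ell ell_diff)
  have "\<xi> = (\<xi> - cut_off E \<xi>) + cut_off E \<xi>" by simp
  then have "\<phi> \<xi> - \<phi> (cut_off E \<xi>) = \<phi> (\<xi> - cut_off E \<xi>)"
    using assms(2) t unfolding ell_functional_def by (metis add_diff_cancel_right')
  then show ?thesis
    using assms(2) t unfolding ell_functional_def by metis
qed

lemma ell_functional_has_sum: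
  assumes "0 < p" "ell_functional p I K \<phi>" "\<xi> \<in> ell p I"
  shows "((\<lambda>r. \<xi> r * \<phi> (delta r)) has_sum \<phi> \<xi>) I"
proof -
  have "((\<lambda>E. K * ell_norm p I (\<xi> - cut_off E \<xi>)) \<longlongrightarrow> K * 0) (finite_subsets_at_top I)"
    by (intro tendsto_intros ell_norm_tail_tendsto_0 assms)
  then have "((\<lambda>E. K * ell_norm p I (\<xi> - cut_off E \<xi>)) \<longlongrightarrow> 0) (finite_subsets_at_top I)"
    by simp
  then have "((\<lambda>E. \<phi> \<xi> - \<phi> (cut_off E \<xi>)) \<longlongrightarrow> 0) (finite_subsets_at_top I)"
    by (rule Lim_null_comparison[OF always_eventually[OF allI], OF ell_functional_tail[OF assms]])
  then have "((\<lambda>E. \<phi> \<xi> - (\<phi> \<xi> - \<phi> (cut_off E \<xi>))) \<longlongrightarrow> \<phi> \<xi> - 0) (finite_subsets_at_top I)"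
    by (intro tendsto_intros)
  then have "((\<lambda>E. \<phi> (cut_off E \<xi>)) \<longlongrightarrow> \<phi> \<xi>) (finite_subsets_at_top I)"
    by simp
  moreover have "\<forall>\<^sub>F E in finite_subsets_at_top I. \<phi> (cut_off E \<xi>) = (\<Sum>r\<in>E. \<xi> r * \<phi> (delta r))"
    by (intro eventually_finite_subsets_at_top_weakI ell_functional_cut_off[OF assms])
  ultimately show ?thesis
    unfolding has_sum_def by (rule Lim_transform_eventually)
qed

lemma ell_functional_tendsto_0:
  assumes "0 < p" "\<And>a. ell_functional p I K (\<phi> a)" "\<xi> \<in> ell p I"
    and lim: "\<And>r. r \<in> I \<Longrightarrow> ((\<lambda>a. \<phi> a (delta r)) \<longlongrightarrow> 0) F"
  shows "((\<lambda>a. \<phi> a \<xi>) \<longlongrightarrow> 0) F"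
proof (rule tendstoI)
  fix e :: real assume "0 < e"
  have "((\<lambda>E. K * ell_norm p I (\<xi> - cut_off E \<xi>)) \<longlongrightarrow> K * 0) (finite_subsets_at_top I)"
    by (intro tendsto_intros ell_norm_tail_tendsto_0 assms)
  then have "\<forall>\<^sub>F E in finite_subsets_at_top I. K * ell_norm p I (\<xi> - cut_off E \<xi>) < e/2"
    by (rule order_tendstoD) (use \<open>0 < e\<close> in simp)
  then obtain E where E: "finite E" "E \<subseteq> I" "K * ell_norm p I (\<xi> - cut_off E \<xi>) < e/2"
    unfolding eventually_finite_subsets_at_top by blast
  have "((\<lambda>a. \<Sum>r\<in>E. \<xi> r * \<phi> a (delta r)) \<longlongrightarrow> (\<Sum>r\<in>E. \<xi> r * 0)) F"
    using E(2) by (intro tendsto_intros lim) auto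
  then have "\<forall>\<^sub>F a in F. norm (\<Sum>r\<in>E. \<xi> r * \<phi> a (delta r)) < e/2"
    using \<open>0 < e\<close> by (auto dest!: tendstoD[where e = "e/2"])
  then show "\<forall>\<^sub>F a in F. dist (\<phi> a \<xi>) 0 < e"
  proof eventually_elim
    case (elim a)
    have "norm (\<phi> a \<xi> - \<phi> a (cut_off E \<xi>)) < e/2"
      using ell_functional_tail[OF assms(1-3), of a E] E(3) by linarith
    moreover have "norm (\<phi> a (cut_off E \<xi>)) < e/2"
      using elim ell_functional_cut_off[OF assms(1-3) E(1,2)] by simp
    ultimately show ?case
      using norm_triangle_ineq[of "\<phi> a \<xi> - \<phi> a (cut_off E \<xi>)" "\<phi> a (cut_off E \<xi>)"]
      by (simp add: dist_norm)
  qed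
qed

section \<open>Bounded operators on \<open>\<ell>\<^sup>p(I)\<close>\<close>

lemma bounded_opsI:
  assumes "\<And>\<xi>. \<xi> \<notin> ell p I \<Longrightarrow> T \<xi> = 0" "\<And>\<xi>. \<xi> \<in> ell p I \<Longrightarrow> T \<xi> \<in> ell p I"
    and "\<And>\<xi> \<eta>. \<xi> \<in> ell p I \<Longrightarrow> \<eta> \<in> ell p I \<Longrightarrow> T (\<xi> + \<eta>) = T \<xi> + T \<eta>"
    and "\<And>\<xi> c. \<xi> \<in> ell p I \<Longrightarrow> T (scale_vec c \<xi>) = scale_vec c (T \<xi>)"
    and "\<And>\<xi>. \<xi> \<in> ell p I \<Longrightarrow> ell_norm p I (T \<xi>) \<le> C * ell_norm p I \<xi>"
  shows "T \<in> bounded_ops p I"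
  unfolding bounded_ops_def mem_Collect_eq using assms by blast

lemma bounded_opsD:
  assumes "T \<in> bounded_ops p I"
  shows "\<xi> \<notin> ell p I \<Longrightarrow> T \<xi> = 0" "\<xi> \<in> ell p I \<Longrightarrow> T \<xi> \<in> ell p I"
    "\<xi> \<in> ell p I \<Longrightarrow> \<eta> \<in> ell p I \<Longrightarrow> T (\<xi> + \<eta>) = T \<xi> + T \<eta>"
    "\<xi> \<in> ell p I \<Longrightarrow> T (scale_vec c \<xi>) = scale_vec c (T \<xi>)"
  using assms by (auto simp: bounded_ops_def)

lemma bounded_ops_zero_vector:
  assumes "T \<in> bounded_ops p I"
  shows "T 0 = 0"
proof -
  have "T 0 = T (scale_vec 0 0)"
    by (rule arg_cong[of _ _ T]) (auto simp: scale_vec_def)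
  also have "\<dots> = scale_vec 0 (T 0)"
    by (rule bounded_opsD(4)[OF assms ell_zero])
  also have "\<dots> = 0"
    by (auto simp: scale_vec_def)
  finally show ?thesis .
qed

lemma bounded_ops_bound:
  assumes "T \<in> bounded_ops p I"
  obtains C where "0 \<le> C" "\<And>\<xi>. \<xi> \<in> ell p I \<Longrightarrow> ell_norm p I (T \<xi>) \<le> C * ell_norm p I \<xi>"
proof -
  obtain C where C: "\<And>\<xi>. \<xi> \<in> ell p I \<Longrightarrow> ell_norm p I (T \<xi>) \<le> C * ell_norm p I \<xi>"
    using assms unfolding bounded_ops_def by blast
  have "ell_norm p I (T \<xi>) \<le> max C 0 * ell_norm p I \<xi>" if "\<xi> \<in> ell p I" for \<xi>
    using C[OF that] mult_right_mono[of C "max C 0" "ell_norm p I \<xi>"] by simp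
  then show ?thesis
    by (intro that[of "max C 0"]) auto
qed

lemma zero_in_bounded_ops: "0 \<in> bounded_ops p I"
proof (rule bounded_opsI)
  show "(0 :: 'a operator) (scale_vec c \<xi>) = scale_vec c ((0 :: 'a operator) \<xi>)" for c \<xi>
    by (auto simp: scale_vec_def)
  show "ell_norm p I ((0 :: 'a operator) \<xi>) \<le> 0 * ell_norm p I \<xi>" for \<xi>
    unfolding zero_fun_apply[of \<xi>] ell_norm_0 by simp
  show "(0 :: 'a operator) \<xi> \<in> ell p I" for \<xi>
    unfolding zero_fun_apply[of \<xi>] by (rule ell_zero)
qed auto

lemma bounded_ops_comp:
  assumes "S \<in> bounded_ops p I" "T \<in> bounded_ops p I"
  shows "S \<circ> T \<in> bounded_ops p I"
proof -
  obtain C where C: "0 \<le> C" "\<And>\<xi>. \<xi> \<in> ell p I \<Longrightarrow> ell_norm p I (S \<xi>) \<le> C * ell_norm p I \<xi>"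
    using bounded_ops_bound[OF assms(1)] by blast
  obtain D where D: "0 \<le> D" "\<And>\<xi>. \<xi> \<in> ell p I \<Longrightarrow> ell_norm p I (T \<xi>) \<le> D * ell_norm p I \<xi>"
    using bounded_ops_bound[OF assms(2)] by blast
  note S = bounded_opsD[OF assms(1)] and T = bounded_opsD[OF assms(2)]
  show ?thesis
  proof (rule bounded_opsI)
    show "(S \<circ> T) \<xi> = 0" if "\<xi> \<notin> ell p I" for \<xi>
      using T(1)[OF that] bounded_ops_zero_vector[OF assms(1)] by (simp only: comp_apply)
    show "ell_norm p I ((S \<circ> T) \<xi>) \<le> (C * D) * ell_norm p I \<xi>" if "\<xi> \<in> ell p I" for \<xi>
    proof -
      have "ell_norm p I (S (T \<xi>)) \<le> C * ell_norm p I (T \<xi>)"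
        by (rule C(2)[OF T(2)[OF that]])
      also have "\<dots> \<le> C * (D * ell_norm p I \<xi>)"
        by (rule mult_left_mono[OF D(2)[OF that] C(1)])
      finally show ?thesis by (simp add: mult.assoc)
    qed
  qed (simp_all only: comp_apply S T)
qed

lemma ell_functional_comp:
  assumes "T \<in> bounded_ops p I" "\<And>\<xi>. \<xi> \<in> ell p I \<Longrightarrow> ell_norm p I (T \<xi>) \<le> C * ell_norm p I \<xi>"
    and "ell_functional p I K \<phi>" "0 \<le> K"
  shows "ell_functional p I (K * C) (\<lambda>\<xi>. \<phi> (T \<xi>))"
  unfolding ell_functional_def
proof (intro conjI ballI allI)
  fix \<xi> assume \<xi>: "\<xi> \<in> ell p I"
  have "norm (\<phi> (T \<xi>)) \<le> K * ell_norm p I (T \<xi>)"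
    using assms(3) bounded_opsD(2)[OF assms(1) \<xi>] by (simp add: ell_functional_def)
  also have "\<dots> \<le> K * (C * ell_norm p I \<xi>)"
    using assms(2)[OF \<xi>] assms(4) by (rule mult_left_mono)
  finally show "norm (\<phi> (T \<xi>)) \<le> K * C * ell_norm p I \<xi>"
    by (simp add: mult.assoc)
qed (use assms bounded_opsD[OF assms(1)] in \<open>auto simp: ell_functional_def\<close>)

lemma ell_functional_coordinate:
  assumes "1 < p" "T \<in> bounded_ops p I" "s \<in> I"
  obtains K where "ell_functional p I K (\<lambda>\<xi>. T \<xi> s)"
proof -
  obtain C where C: "0 \<le> C" "\<And>\<xi>. \<xi> \<in> ell p I \<Longrightarrow> ell_norm p I (T \<xi>) \<le> C * ell_norm p I \<xi>"
    using bounded_ops_bound[OF assms(2)] by blast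
  have "ell_functional p I (ell_norm (conj_exponent p) I (delta s) * C) (\<lambda>\<xi>. ell_pairing I (delta
      s) (T \<xi>))"
    by (rule ell_functional_comp[OF assms(2) C(2) ell_functional_pairing]) (use assms in auto)
  then show ?thesis
    using that ell_pairing_delta[OF assms(3)] by simp
qed

text \<open>An operator acts as a matrix: the entry of \<open>T\<close> at \<open>(s, r)\<close> is \<open>T (delta r) s\<close>, and the rows are
  summed unconditionally.\<close>

lemma bounded_op_has_sum:
  assumes "1 < p" "T \<in> bounded_ops p I" "s \<in> I" "\<xi> \<in> ell p I"
  shows "((\<lambda>r. \<xi> r * T (delta r) s) has_sum T \<xi> s) I"
proof -
  obtain K where "ell_functional p I K (\<lambda>\<xi>. T \<xi> s)"
    by (rule ell_functional_coordinate[OF assms(1-3)])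
  then show ?thesis
    using ell_functional_has_sum[of p I K "\<lambda>\<xi>. T \<xi> s"] assms by auto
qed

section \<open>Weak*-convergence of bounded nets of operators\<close>

text \<open>It suffices to test a limit on the subbasic open sets.\<close>

lemma limitin_weakstarI:
  assumes "T \<in> bounded_ops p I" "\<And>a. f a \<in> bounded_ops p I"
    and lim: "\<And>u. u \<in> proj_tensors p I \<Longrightarrow>
      ((\<lambda>a. tensor_duality I u (f a)) \<longlongrightarrow> tensor_duality I u T) F"
  shows "limitin (weakstar_topology p I) f T F"
  unfolding limitin_def
proof (intro conjI allI impI)
  fix U assume "openin (weakstar_topology p I) U \<and> T \<in> U"
  then have "generate_topology_on
      {{T \<in> bounded_ops p I. tensor_duality I u T \<in> U} | u U. u \<in> proj_tensors p I \<and> open U} U" "T \<in> U"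
    by (auto simp: weakstar_topology_def openin_topology_generated_by_iff)
  then show "\<forall>\<^sub>F a in F. f a \<in> U"
  proof induction
    case (Basis s)
    then obtain u V where uV: "u \<in> proj_tensors p I" "open V"
        "s = {T \<in> bounded_ops p I. tensor_duality I u T \<in> V}"
      by blast
    then have "\<forall>\<^sub>F a in F. tensor_duality I u (f a) \<in> V"
      using topological_tendstoD[OF lim[OF uV(1)] uV(2)] Basis.prems by blast
    then show ?case
      by eventually_elim (use uV(3) assms(2) in auto)
  next
    case (UN K)
    then obtain k where "k \<in> K" "T \<in> k" by blast
    then show ?case
      using UN.IH[of k] by (auto elim: eventually_mono)
  qed (auto intro: eventually_conj)
qed (use assms(1) in simp)

lemma ell_functional_mono: "ell_functional p I K \<phi> \<Longrightarrow> K \<le> L \<Longrightarrow> ell_functional p I L \<phi>"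
  unfolding ell_functional_def by (meson ell_norm_nonneg mult_right_mono order_trans)

lemma ell_functional_minus:
  assumes "ell_functional p I K \<phi>" "ell_functional p I L \<psi>"
  shows "ell_functional p I (K + L) (\<lambda>\<xi>. \<phi> \<xi> - \<psi> \<xi>)"
  unfolding ell_functional_def
proof (intro conjI ballI allI)
  fix \<xi> assume \<xi>: "\<xi> \<in> ell p I"
  have "norm (\<phi> \<xi> - \<psi> \<xi>) \<le> norm (\<phi> \<xi>) + norm (\<psi> \<xi>)"
    by (rule norm_triangle_ineq4)
  also have "\<dots> \<le> K * ell_norm p I \<xi> + L * ell_norm p I \<xi>"
    using assms \<xi> by (intro add_mono) (auto simp: ell_functional_def)
  finally show "norm (\<phi> \<xi> - \<psi> \<xi>) \<le> (K + L) * ell_norm p I \<xi>"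
    by (simp add: algebra_simps)
qed (use assms in \<open>auto simp: ell_functional_def algebra_simps\<close>)

text \<open>The vectors \<open>\<xi>\<close> and \<open>\<eta>\<close> are approximated by finitely supported ones, first \<open>\<xi>\<close> with \<open>\<eta>\<close> a
  \<open>delta s\<close>, then \<open>\<eta>\<close> with \<open>\<xi>\<close> arbitrary; the second step uses that \<open>\<ell>\<^sup>p\<close> is in turn the dual of
  \<open>\<ell>\<^sup>q\<close> for the conjugate exponent \<open>q\<close>.\<close>

lemma pairing_tendsto:
  assumes "1 < p" "T \<in> bounded_ops p I" "\<And>a. f a \<in> bounded_ops p I"
    and bound: "\<And>a \<xi>. \<xi> \<in> ell p I \<Longrightarrow> ell_norm p I (f a \<xi>) \<le> C * ell_norm p I \<xi>"
    and lim: "\<And>r s. r \<in> I \<Longrightarrow> s \<in> I \<Longrightarrow> ((\<lambda>a. f a (delta r) s) \<longlongrightarrow> T (delta r) s) F"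
    and \<eta>: "\<eta> \<in> ell (conj_exponent p) I" and \<xi>: "\<xi> \<in> ell p I"
  shows "((\<lambda>a. ell_pairing I \<eta> (f a \<xi>)) \<longlongrightarrow> ell_pairing I \<eta> (T \<xi>)) F"
proof -
  let ?q = "conj_exponent p"
  have q: "1 < ?q" "conj_exponent ?q = p"
    using assms(1) conj_exponent_gt_1 conj_exponent_involutive by auto
  obtain D where D: "0 \<le> D" "\<And>\<xi>. \<xi> \<in> ell p I \<Longrightarrow> ell_norm p I (T \<xi>) \<le> D * ell_norm p I \<xi>"
    using bounded_ops_bound[OF assms(2)] by blast
  have *: "((\<lambda>a. f a \<xi> s - T \<xi> s) \<longlongrightarrow> 0) F" if s: "s \<in> I" for s
  proof (rule ell_functional_tendsto_0[OF _ _ \<xi>])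
    let ?N = "ell_norm ?q I (delta s)"
    have "ell_functional p I (?N * C + ?N * D)
        (\<lambda>\<xi>. ell_pairing I (delta s) (f a \<xi>) - ell_pairing I (delta s) (T \<xi>))" for a
      using s assms(1)
      by (intro ell_functional_minus ell_functional_comp[OF assms(3) bound]
          ell_functional_comp[OF assms(2) D(2)] ell_functional_pairing) auto
    then show "ell_functional p I (?N * C + ?N * D) (\<lambda>\<xi>. f a \<xi> s - T \<xi> s)" for a
      using s by (simp add: ell_pairing_delta)
    show "((\<lambda>a. f a (delta r) s - T (delta r) s) \<longlongrightarrow> 0) F" if "r \<in> I" for r
      using lim[OF that s] by (rule LIM_zero)
  qed (use assms(1) in simp)
  have "((\<lambda>a. ell_pairing I (f a \<xi>) \<eta> - ell_pairing I (T \<xi>) \<eta>) \<longlongrightarrow> 0) F"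
  proof (rule ell_functional_tendsto_0[OF _ _ \<eta>])
    show "ell_functional ?q I (C * ell_norm p I \<xi> + D * ell_norm p I \<xi>)
        (\<lambda>\<eta>. ell_pairing I (f a \<xi>) \<eta> - ell_pairing I (T \<xi>) \<eta>)" for a
    proof (rule ell_functional_minus)
      show "ell_functional ?q I (C * ell_norm p I \<xi>) (ell_pairing I (f a \<xi>))"
        using ell_functional_pairing[OF q(1), of "f a \<xi>" I] bounded_opsD(2)[OF assms(3) \<xi>] q(2)
        by (intro ell_functional_mono[OF _ bound[OF \<xi>]]) simp
      show "ell_functional ?q I (D * ell_norm p I \<xi>) (ell_pairing I (T \<xi>))"
        using ell_functional_pairing[OF q(1), of "T \<xi>" I] bounded_opsD(2)[OF assms(2) \<xi>] q(2)
        by (intro ell_functional_mono[OF _ D(2)[OF \<xi>]]) simp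
    qed
    show "((\<lambda>a. ell_pairing I (f a \<xi>) (delta s) - ell_pairing I (T \<xi>) (delta s)) \<longlongrightarrow> 0) F"
      if "s \<in> I" for s
      using *[OF that] that by (simp add: ell_pairing_commute[of I _ "delta s"] ell_pairing_delta)
  qed (use q in simp)
  then show ?thesis
    unfolding ell_pairing_commute[of I \<eta>] by (rule LIM_zero_cancel)
qed

text \<open>On bounded nets the weak*-topology is the topology of entrywise convergence: elementary tensors
  are handled by density, and Tannery's theorem exchanges the limit with the sum over the tensor.
  Both halves of the main theorem obtain their limits from this.\<close>

theorem limitin_weakstar_bounded:
  assumes "1 < p" "T \<in> bounded_ops p I" "\<And>a. f a \<in> bounded_ops p I"
    and bound: "\<And>a \<xi>. \<xi> \<in> ell p I \<Longrightarrow> ell_norm p I (f a \<xi>) \<le> C * ell_norm p I \<xi>"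
    and lim: "\<And>r s. r \<in> I \<Longrightarrow> s \<in> I \<Longrightarrow> ((\<lambda>a. f a (delta r) s) \<longlongrightarrow> T (delta r) s) F"
    and "F \<noteq> bot"
  shows "limitin (weakstar_topology p I) f T F"
proof (rule limitin_weakstarI[OF assms(2,3)])
  fix u assume "u \<in> proj_tensors p I"
  then obtain \<eta> \<xi> where u: "u = (\<eta>, \<xi>)" "\<And>j. \<eta> j \<in> ell (conj_exponent p) I" "\<And>j. \<xi> j \<in> ell p I"
      "summable (\<lambda>j. ell_norm (conj_exponent p) I (\<eta> j) * ell_norm p I (\<xi> j))"
    by (auto simp: proj_tensors_def)
  let ?M = "\<lambda>j. C * (ell_norm (conj_exponent p) I (\<eta> j) * ell_norm p I (\<xi> j))"
  have le: "norm (ell_pairing I (\<eta> j) (f a (\<xi> j))) \<le> ?M j" for j a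
  proof -
    have "ell_functional p I (ell_norm (conj_exponent p) I (\<eta> j) * C) (\<lambda>\<xi>. ell_pairing I (\<eta> j) (f a \<xi>))"
      by (intro ell_functional_comp[OF assms(3) bound] ell_functional_pairing assms(1) u(2)) auto
    then show ?thesis
      using u(3)[of j] by (simp add: ell_functional_def algebra_simps)
  qed
  have "\<forall>\<^sub>F (j, a) in at_top \<times>\<^sub>F F. norm (ell_pairing I (\<eta> j) (f a (\<xi> j))) \<le> ?M j"
    using le by (intro always_eventually) auto
  from tannerys_theorem[OF pairing_tendsto[OF assms(1-3) bound lim u(2,3)] this summable_mult[OF
      u(4)] \<open>F \<noteq> bot\<close>]
  have "((\<lambda>a. \<Sum>j. ell_pairing I (\<eta> j) (f a (\<xi> j))) \<longlongrightarrow> (\<Sum>j. ell_pairing I (\<eta> j) (T (\<xi> j)))) F"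
    by blast
  then show "((\<lambda>a. tensor_duality I u (f a)) \<longlongrightarrow> tensor_duality I u T) F"
    by (simp add: tensor_duality_def u(1))
qed

text \<open>The pairing with \<open>\<eta>\<close> and \<open>\<xi>\<close> is the functional of the elementary tensor \<open>\<eta> \<otimes> \<xi>\<close>.\<close>

lemma closedin_weakstar_annihilator:
  assumes "\<eta> \<in> ell (conj_exponent p) I" "\<xi> \<in> ell p I"
  shows "closedin (weakstar_topology p I) {T \<in> bounded_ops p I. ell_pairing I \<eta> (T \<xi>) = 0}"
proof -
  define u :: "(nat \<Rightarrow> 'a \<Rightarrow> complex) \<times> (nat \<Rightarrow> 'a \<Rightarrow> complex)"
    where "u = ((\<lambda>j. if j = 0 then \<eta> else 0), (\<lambda>j. if j = 0 then \<xi> else 0))"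
  have "u \<in> proj_tensors p I"
    using assms
    by (auto simp: u_def proj_tensors_def ell_zero intro!: summable_finite[of "{0}"] split: if_splits)
  then have "openin (weakstar_topology p I) {T \<in> bounded_ops p I. tensor_duality I u T \<in> - {0}}"
    unfolding weakstar_topology_def openin_topology_generated_by_iff
    by (intro generate_topology_on.Basis CollectI exI[of _ u] exI[of _ "- {0}"]) auto
  moreover have "tensor_duality I u T = ell_pairing I \<eta> (T \<xi>)" for T
    unfolding tensor_duality_def by (subst suminf_finite[of "{0}"]) (auto simp: u_def ell_pairing_def)
  moreover have "{T \<in> bounded_ops p I. ell_pairing I \<eta> (T \<xi>) \<in> - {0}} =
      bounded_ops p I - {T \<in> bounded_ops p I. ell_pairing I \<eta> (T \<xi>) = 0}"
    by auto
  ultimately have "openin (weakstar_topology p I)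
      (bounded_ops p I - {T \<in> bounded_ops p I. ell_pairing I \<eta> (T \<xi>) = 0})"
    by simp
  then show ?thesis
    by (auto simp: closedin_def)
qed

section \<open>Convolution on a discrete group\<close>

text \<open>The sum is defined for arbitrary \<open>f\<close> and \<open>\<xi>\<close>, so that one operation serves as the product of
  \<open>\<ell>\<^sup>1(G)\<close> and as its action on \<open>\<ell>\<^sup>p(G)\<close>. For \<open>f\<close> in \<open>\<ell>\<^sup>1(G)\<close> and bounded \<open>\<xi>\<close> it converges
  absolutely.\<close>

definition convolve :: "('a, 'b) monoid_scheme \<Rightarrow> ('a \<Rightarrow> complex) \<Rightarrow> ('a \<Rightarrow> complex) \<Rightarrow> 'a \<Rightarrow> complex" where
  "convolve G f \<xi> = (\<lambda>s. if s \<in> carrier G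
     then \<Sum>\<^sub>\<infinity>t\<in>carrier G. f t * \<xi> (inv\<^bsub>G\<^esub> t \<otimes>\<^bsub>G\<^esub> s) else 0)"

lemma ell_1_iff: "f \<in> ell 1 I \<longleftrightarrow> (\<forall>s. s \<notin> I \<longrightarrow> f s = 0) \<and> (\<lambda>s. norm (f s)) summable_on I"
  by (simp add: ell_def)

lemma ell_norm_1: "ell_norm 1 I f = (\<Sum>\<^sub>\<infinity>s\<in>I. norm (f s))"
  by (simp add: ell_norm_def infsum_nonneg)

lemma ell_1_summable: "f \<in> ell 1 I \<Longrightarrow> f summable_on I"
  by (auto simp: ell_1_iff intro: Infinite_Sum.abs_summable_summable)

lemma infsum_of_real_complex:
  "(\<Sum>\<^sub>\<infinity>x\<in>A. complex_of_real (f x)) = complex_of_real (\<Sum>\<^sub>\<infinity>x\<in>A. f x)"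
proof (cases "f summable_on A")
  case True
  then show ?thesis
    by (intro infsumI has_sum_of_real has_sum_infsum)
next
  case False
  then have "\<not> (\<lambda>x. complex_of_real (f x)) summable_on A"
    using summable_on_Re[of "\<lambda>x. complex_of_real (f x)" A] by auto
  with False show ?thesis
    by (simp add: infsum_not_exists)
qed

context group begin

abbreviation conv (infixr "\<star>" 70) where "conv \<equiv> convolve G"

lemma bij_left_div: "s \<in> carrier G \<Longrightarrow> bij_betw (\<lambda>t. inv t \<otimes> s) (carrier G) (carrier G)"
  by (rule bij_betwI[where g = "\<lambda>r. s \<otimes> inv r"]) (auto simp: inv_mult_group m_assoc,
      simp add: m_assoc[symmetric])

lemma bij_left_mult: "t \<in> carrier G \<Longrightarrow> bij_betw (\<lambda>s. inv t \<otimes> s) (carrier G) (carrier G)"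
  by (rule bij_betwI[where g = "\<lambda>r. t \<otimes> r"]) (auto simp: m_assoc[symmetric])

lemma conv_right_kernel:
  assumes "s \<in> carrier G"
  shows "(f \<star> \<xi>) s = (\<Sum>\<^sub>\<infinity>r\<in>carrier G. f (s \<otimes> inv r) * \<xi> r)"
proof -
  have "f t * \<xi> (inv t \<otimes> s) = f (s \<otimes> inv (inv t \<otimes> s)) * \<xi> (inv t \<otimes> s)" if "t \<in> carrier G" for t
  proof -
    have "s \<otimes> inv (inv t \<otimes> s) = t"
      using assms that by (simp add: inv_mult_group m_assoc[symmetric])
    then show ?thesis by simp
  qed
  then have "(f \<star> \<xi>) s = (\<Sum>\<^sub>\<infinity>t\<in>carrier G. f (s \<otimes> inv (inv t \<otimes> s)) * \<xi> (inv t \<otimes> s))"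
    using assms unfolding convolve_def by (auto intro: infsum_cong)
  also have "\<dots> = (\<Sum>\<^sub>\<infinity>r\<in>carrier G. f (s \<otimes> inv r) * \<xi> r)"
    by (rule infsum_reindex_bij_betw[OF bij_left_div[OF assms], of "\<lambda>r. f (s \<otimes> inv r) * \<xi> r"])
  finally show ?thesis .
qed

lemma conv_abs_summable:
  assumes "f \<in> ell 1 (carrier G)" "\<And>s. norm (\<xi> s) \<le> M"
  shows "(\<lambda>t. norm (f t * \<xi> (inv t \<otimes> s))) summable_on carrier G"
proof (rule Infinite_Sum.abs_summable_on_comparison_test')
  show "(\<lambda>t. norm (f t) * M) summable_on carrier G"
    using assms(1) by (intro summable_on_cmult_left) (simp add: ell_1_iff)
qed (use assms(2) in \<open>auto simp: norm_mult intro: mult_left_mono\<close>)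

lemmas conv_summable = Infinite_Sum.abs_summable_summable[OF conv_abs_summable]

lemma conv_add_right:
  assumes "f \<in> ell 1 (carrier G)" "\<And>s. norm (\<xi> s) \<le> M" "\<And>s. norm (\<eta> s) \<le> N"
  shows "f \<star> (\<xi> + \<eta>) = f \<star> \<xi> + f \<star> \<eta>"
proof
  fix s
  have "(\<lambda>t. f t * \<xi> (inv t \<otimes> s)) summable_on carrier G"
    by (rule conv_summable) (fact assms)+
  moreover have "(\<lambda>t. f t * \<eta> (inv t \<otimes> s)) summable_on carrier G"
    by (rule conv_summable) (fact assms)+
  ultimately show "(f \<star> (\<xi> + \<eta>)) s = (f \<star> \<xi> + f \<star> \<eta>) s"
    using infsum_add[of "\<lambda>t. f t * \<xi> (inv t \<otimes> s)" _ "\<lambda>t. f t * \<eta> (inv t \<otimes> s)"]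
    by (simp add: convolve_def algebra_simps)
qed

lemma conv_add_left:
  assumes "f \<in> ell 1 (carrier G)" "g \<in> ell 1 (carrier G)" "\<And>s. norm (\<xi> s) \<le> M"
  shows "(f + g) \<star> \<xi> = f \<star> \<xi> + g \<star> \<xi>"
proof
  fix s
  have "(\<lambda>t. f t * \<xi> (inv t \<otimes> s)) summable_on carrier G"
    by (rule conv_summable) (fact assms)+
  moreover have "(\<lambda>t. g t * \<xi> (inv t \<otimes> s)) summable_on carrier G"
    by (rule conv_summable) (fact assms)+
  ultimately show "((f + g) \<star> \<xi>) s = (f \<star> \<xi> + g \<star> \<xi>) s"
    using infsum_add[of "\<lambda>t. f t * \<xi> (inv t \<otimes> s)" _ "\<lambda>t. g t * \<xi> (inv t \<otimes> s)"]
    by (simp add: convolve_def algebra_simps)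
qed

lemma conv_scale_right: "f \<star> scale_vec c \<xi> = scale_vec c (f \<star> \<xi>)"
proof
  fix s
  show "(f \<star> scale_vec c \<xi>) s = scale_vec c (f \<star> \<xi>) s"
    unfolding convolve_def scale_vec_def
    by (simp add: mult.left_commute[of _ c] infsum_cmult_right')
qed

lemma conv_scale_left: "scale_vec c f \<star> \<xi> = scale_vec c (f \<star> \<xi>)"
proof
  fix s
  show "(scale_vec c f \<star> \<xi>) s = scale_vec c (f \<star> \<xi>) s"
    unfolding convolve_def scale_vec_def
    by (simp add: mult.assoc infsum_cmult_right')
qed

lemma conv_zero_left [simp]: "0 \<star> \<xi> = 0" and conv_zero_right [simp]: "f \<star> 0 = 0"
  by (auto simp: convolve_def)

lemma delta_conv:
  assumes "t \<in> carrier G"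
  shows "delta t \<star> \<xi> = (\<lambda>s. if s \<in> carrier G then \<xi> (inv t \<otimes> s) else 0)"
proof
  fix s
  show "(delta t \<star> \<xi>) s = (if s \<in> carrier G then \<xi> (inv t \<otimes> s) else 0)"
    unfolding convolve_def
    using infsum_cong_neutral[of "{t}" "carrier G" "\<lambda>t. \<xi> (inv t \<otimes> s)"
        "\<lambda>u. delta t u * \<xi> (inv u \<otimes> s)"] assms
    by (auto simp: delta_def)
qed

lemma conv_delta:
  assumes "r \<in> carrier G"
  shows "f \<star> delta r = (\<lambda>s. if s \<in> carrier G then f (s \<otimes> inv r) else 0)"
proof
  fix s
  show "(f \<star> delta r) s = (if s \<in> carrier G then f (s \<otimes> inv r) else 0)"
  proof (cases "s \<in> carrier G")
    case True
    then show ?thesis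
      using infsum_cong_neutral[of "{r}" "carrier G" "\<lambda>r. f (s \<otimes> inv r)"
          "\<lambda>u. f (s \<otimes> inv u) * delta r u"] assms
      by (auto simp: conv_right_kernel delta_def)
  qed (simp add: convolve_def)
qed

lemma conv_delta_one: "(\<And>s. s \<notin> carrier G \<Longrightarrow> f s = 0) \<Longrightarrow> f \<star> delta \<one> = f"
  by (auto simp: conv_delta)

lemma delta_conv_delta: "t \<in> carrier G \<Longrightarrow> u \<in> carrier G \<Longrightarrow> delta t \<star> delta u = delta (t \<otimes> u)"
  by (auto simp: delta_conv fun_eq_iff) (auto simp: delta_def inv_solve_left')

lemma conv_kernel_abs_summable:
  assumes "f \<in> ell 1 (carrier G)" "g \<in> ell 1 (carrier G)"
  shows "(\<lambda>(t, v). norm (f t * g (inv t \<otimes> v))) summable_on carrier G \<times> carrier G"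
proof -
  have g: "(\<lambda>v. norm (g (inv t \<otimes> v))) summable_on carrier G"
      "(\<Sum>\<^sub>\<infinity>v\<in>carrier G. norm (g (inv t \<otimes> v))) = ell_norm 1 (carrier G) g" if "t \<in> carrier G" for t
    using summable_on_reindex_bij_betw[OF bij_left_mult[OF that], of "\<lambda>v. norm (g v)"]
      infsum_reindex_bij_betw[OF bij_left_mult[OF that], of "\<lambda>v. norm (g v)"] assms(2)
    by (auto simp: ell_1_iff ell_norm_1)
  have 1: "(\<lambda>v. norm (f t * g (inv t \<otimes> v))) summable_on carrier G" if "t \<in> carrier G" for t
    using g(1)[OF that] by (auto simp: norm_mult intro: summable_on_cmult_right)
  have "(\<Sum>\<^sub>\<infinity>v\<in>carrier G. norm (f t * g (inv t \<otimes> v))) = norm (f t) * ell_norm 1 (carrier G) g"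
    if "t \<in> carrier G" for t
    using g[OF that] by (simp add: norm_mult infsum_cmult_right)
  then have "(\<lambda>t. norm (\<Sum>\<^sub>\<infinity>v\<in>carrier G. norm (f t * g (inv t \<otimes> v)))) summable_on carrier G
      \<longleftrightarrow> (\<lambda>t. norm (f t) * ell_norm 1 (carrier G) g) summable_on carrier G"
    by (intro summable_on_cong) simp
  then have 2: "(\<lambda>t. norm (\<Sum>\<^sub>\<infinity>v\<in>carrier G. norm (f t * g (inv t \<otimes> v)))) summable_on carrier G"
    using assms(1) by (auto simp: ell_1_iff intro: summable_on_cmult_left)
  have "(\<lambda>z. norm ((\<lambda>(t, v). f t * g (inv t \<otimes> v)) z)) summable_on carrier G \<times> carrier G"
    unfolding Infinite_Sum.abs_summable_on_Sigma_iff using 1 2 by simp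
  then show ?thesis
    by (simp add: case_prod_unfold)
qed

text \<open>The case \<open>\<xi> = 1\<close> makes the sum of the coefficients multiplicative, the case of a translate of \<open>\<xi>\<close>
  gives associativity.\<close>

lemma conv_kernel_swap:
  assumes "f \<in> ell 1 (carrier G)" "g \<in> ell 1 (carrier G)" "\<And>s. norm (\<xi> s) \<le> M"
  shows "(\<Sum>\<^sub>\<infinity>t\<in>carrier G. \<Sum>\<^sub>\<infinity>v\<in>carrier G. f t * g (inv t \<otimes> v) * \<xi> v) =
    (\<Sum>\<^sub>\<infinity>v\<in>carrier G. \<Sum>\<^sub>\<infinity>t\<in>carrier G. f t * g (inv t \<otimes> v) * \<xi> v)"
proof (rule infsum_swap_banach)
  have "(\<lambda>z. norm ((\<lambda>(t, v). f t * g (inv t \<otimes> v) * \<xi> v) z)) summable_on carrier G \<times> carrier G"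
    by (rule Infinite_Sum.abs_summable_on_comparison_test'[OF
        summable_on_cmult_left[OF conv_kernel_abs_summable[OF assms(1,2)], of M]])
       (use assms(3) in \<open>auto simp: norm_mult intro!: mult_left_mono\<close>)
  then show "(\<lambda>(t, v). f t * g (inv t \<otimes> v) * \<xi> v) summable_on carrier G \<times> carrier G"
    by (rule Infinite_Sum.abs_summable_summable)
qed

lemma conv_in_ell_1:
  assumes "f \<in> ell 1 (carrier G)" "g \<in> ell 1 (carrier G)"
  shows "f \<star> g \<in> ell 1 (carrier G)"
proof -
  have "(\<lambda>(v, t). norm (f t * g (inv t \<otimes> v))) summable_on carrier G \<times> carrier G"
    using conv_kernel_abs_summable[OF assms] by (subst (asm) summable_on_swap) simp
  then have "(\<lambda>v. \<Sum>\<^sub>\<infinity>t\<in>carrier G. norm (f t * g (inv t \<otimes> v))) summable_on carrier G"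
    using summable_on_Sigma_banach[of "\<lambda>v t. norm (f t * g (inv t \<otimes> v))"] by simp
  then have "(\<lambda>v. norm ((f \<star> g) v)) summable_on carrier G"
    by (rule Infinite_Sum.abs_summable_on_comparison_test')
       (auto simp: convolve_def intro!: norm_infsum_bound conv_abs_summable[OF assms(1)
           norm_le_ell_norm[OF _ assms(2)]])
  then show ?thesis
    by (simp add: ell_1_iff convolve_def)
qed

lemma infsum_conv:
  assumes "f \<in> ell 1 (carrier G)" "g \<in> ell 1 (carrier G)"
  shows "infsum (f \<star> g) (carrier G) = infsum f (carrier G) * infsum g (carrier G)"
proof -
  have "infsum (f \<star> g) (carrier G) = (\<Sum>\<^sub>\<infinity>v\<in>carrier G. \<Sum>\<^sub>\<infinity>t\<in>carrier G. f t * g (inv t \<otimes> v))"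
    by (rule infsum_cong) (simp add: convolve_def)
  also have "\<dots> = (\<Sum>\<^sub>\<infinity>t\<in>carrier G. \<Sum>\<^sub>\<infinity>v\<in>carrier G. f t * g (inv t \<otimes> v))"
    using conv_kernel_swap[OF assms, of "\<lambda>_. 1" 1] by simp
  also have "\<dots> = (\<Sum>\<^sub>\<infinity>t\<in>carrier G. f t * infsum g (carrier G))"
    by (rule infsum_cong) (simp add: infsum_cmult_right' infsum_reindex_bij_betw[OF bij_left_mult])
  finally show ?thesis
    by (simp add: infsum_cmult_left')
qed

lemma conv_assoc:
  assumes "f \<in> ell 1 (carrier G)" "g \<in> ell 1 (carrier G)" "\<And>s. norm (\<xi> s) \<le> M"
  shows "(f \<star> g) \<star> \<xi> = f \<star> (g \<star> \<xi>)"
proof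
  fix s
  show "((f \<star> g) \<star> \<xi>) s = (f \<star> (g \<star> \<xi>)) s"
  proof (cases "s \<in> carrier G")
    case s: True
    have "((f \<star> g) \<star> \<xi>) s = (\<Sum>\<^sub>\<infinity>v\<in>carrier G. (\<Sum>\<^sub>\<infinity>t\<in>carrier G. f t * g (inv t \<otimes> v)) * \<xi> (inv v \<otimes> s))"
      using s by (simp add: convolve_def cong: infsum_cong)
    also have "\<dots> = (\<Sum>\<^sub>\<infinity>v\<in>carrier G. \<Sum>\<^sub>\<infinity>t\<in>carrier G. f t * g (inv t \<otimes> v) * \<xi> (inv v \<otimes> s))"
      by (simp add: infsum_cmult_left')
    also have "\<dots> = (\<Sum>\<^sub>\<infinity>t\<in>carrier G. \<Sum>\<^sub>\<infinity>v\<in>carrier G. f t * g (inv t \<otimes> v) * \<xi> (inv v \<otimes> s))"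
      by (rule conv_kernel_swap[symmetric, OF assms(1,2), where M = M]) (rule assms(3))
    also have "\<dots> = (\<Sum>\<^sub>\<infinity>t\<in>carrier G. f t * (g \<star> \<xi>) (inv t \<otimes> s))"
    proof (rule infsum_cong)
      fix t assume t: "t \<in> carrier G"
      have "(g \<star> \<xi>) (inv t \<otimes> s) = (\<Sum>\<^sub>\<infinity>u\<in>carrier G. g u * \<xi> (inv u \<otimes> (inv t \<otimes> s)))"
        using s t by (simp add: convolve_def)
      also have "\<dots> = (\<Sum>\<^sub>\<infinity>v\<in>carrier G. g (inv t \<otimes> v) * \<xi> (inv (inv t \<otimes> v) \<otimes> (inv t \<otimes> s)))"
        by (rule infsum_reindex_bij_betw[OF bij_left_mult[OF t], symmetric])
      also have "\<dots> = (\<Sum>\<^sub>\<infinity>v\<in>carrier G. g (inv t \<otimes> v) * \<xi> (inv v \<otimes> s))"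
      proof (rule infsum_cong)
        fix v assume v: "v \<in> carrier G"
        have "inv (inv t \<otimes> v) \<otimes> (inv t \<otimes> s) = inv v \<otimes> (t \<otimes> inv t) \<otimes> s"
          using s t v by (simp only: inv_mult_group inv_inv inv_closed m_closed m_assoc)
        then show "g (inv t \<otimes> v) * \<xi> (inv (inv t \<otimes> v) \<otimes> (inv t \<otimes> s)) = g (inv t \<otimes> v) * \<xi> (inv v \<otimes> s)"
          using s t v by simp
      qed
      finally show "(\<Sum>\<^sub>\<infinity>v\<in>carrier G. f t * g (inv t \<otimes> v) * \<xi> (inv v \<otimes> s)) = f t * (g \<star> \<xi>) (inv t \<otimes> s)"
        by (simp add: mult.assoc infsum_cmult_right')
    qed
    also have "\<dots> = (f \<star> (g \<star> \<xi>)) s"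
      using s by (simp add: convolve_def)
    finally show ?thesis .
  qed (simp add: convolve_def)
qed

text \<open>The factorisation \<open>|f| |\<xi>| = |f|\<^bsup>1/q\<^esup> (|f|\<^bsup>1/p\<^esup> |\<xi>|)\<close> and Hoelder bound \<open>|f \<star> \<xi>|\<^sup>p\<close> by a
  constant times the convolution of \<open>|f|\<close> and \<open>|\<xi>|\<^sup>p\<close>, two functions in \<open>\<ell>\<^sup>1(G)\<close>. The sum of that
  convolution is the product of the two sums.\<close>

theorem Young_inequality_conv:
  assumes "1 < p" and f: "f \<in> ell 1 (carrier G)" and \<xi>: "\<xi> \<in> ell p (carrier G)"
  shows "f \<star> \<xi> \<in> ell p (carrier G)"
    and "ell_norm p (carrier G) (f \<star> \<xi>) \<le> ell_norm 1 (carrier G) f * ell_norm p (carrier G) \<xi>"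
proof -
  define q where "q = conj_exponent p"
  have q: "1 < q" "1/p + 1/q = 1"
    using assms conj_exponent_gt_1 conj_exponent_eq by (auto simp: q_def)
  define N where "N = ell_norm 1 (carrier G) f"
  define F where "F = (\<lambda>s. complex_of_real (norm (f s)))"
  define X where "X = (\<lambda>s. complex_of_real (norm (\<xi> s) powr p))"
  have F: "F \<in> ell 1 (carrier G)" and X: "X \<in> ell 1 (carrier G)"
    using f \<xi> by (auto simp: F_def X_def ell_def)
  note FX = conv_in_ell_1[OF F X]
  have FX_real: "norm ((F \<star> X) s) = (\<Sum>\<^sub>\<infinity>t\<in>carrier G. norm (f t) * norm (\<xi> (inv t \<otimes> s)) powr p)"
    and FX_of_real: "(F \<star> X) s = complex_of_real (norm ((F \<star> X) s))" if "s \<in> carrier G" for s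
  proof -
    have "(F \<star> X) s = (\<Sum>\<^sub>\<infinity>t\<in>carrier G. complex_of_real (norm (f t) * norm (\<xi> (inv t \<otimes> s)) powr p))"
      using that by (simp add: convolve_def F_def X_def)
    also have "\<dots> = complex_of_real (\<Sum>\<^sub>\<infinity>t\<in>carrier G. norm (f t) * norm (\<xi> (inv t \<otimes> s)) powr p)"
      by (rule infsum_of_real_complex)
    finally have *: "(F \<star> X) s = \<dots>" .
    then show "norm ((F \<star> X) s) = (\<Sum>\<^sub>\<infinity>t\<in>carrier G. norm (f t) * norm (\<xi> (inv t \<otimes> s)) powr p)"
      by (simp add: infsum_nonneg)
    with * show "(F \<star> X) s = complex_of_real (norm ((F \<star> X) s))" by simp
  qed
  \<comment> \<open>Hoelder's inequality for the two factors \<open>|f|\<^bsup>1/q\<^esup>\<close> and \<open>|f|\<^bsup>1/p\<^esup> |\<xi>|\<close> at a fixed \<open>s\<close>\<close>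
  have pointwise: "norm ((f \<star> \<xi>) s) powr p \<le> N powr (p / q) * norm ((F \<star> X) s)" if s:
      "s \<in> carrier G" for s
  proof -
    define a where "a = (\<lambda>t. complex_of_real (norm (f t) powr (1/q)))"
    define b where "b = (\<lambda>t. if t \<in> carrier G then complex_of_real (norm (f t) powr (1/p) * norm
        (\<xi> (inv t \<otimes> s))) else 0)"
    have a: "a \<in> ell q (carrier G)" "ell_norm q (carrier G) a = N powr (1/q)"
      using f q(1) by (auto simp: a_def ell_def ell_norm_def N_def powr_powr infsum_nonneg)
    have pow: "norm (b t) powr p = norm (f t) * norm (\<xi> (inv t \<otimes> s)) powr p" if "t \<in> carrier G" for t
      using assms(1) that by (simp add: b_def norm_mult powr_mult powr_powr)
    have "(\<lambda>t. norm (F t * X (inv t \<otimes> s))) summable_on carrier G"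
      by (rule conv_abs_summable[OF F norm_le_ell_norm[OF _ X]]) simp
    then have "(\<lambda>t. norm (b t) powr p) summable_on carrier G"
      by (rule summable_on_cong[THEN iffD1, rotated]) (simp add: pow F_def X_def norm_mult)
    then have b: "b \<in> ell p (carrier G)"
      by (simp add: ell_def b_def)
    have b_norm: "ell_norm p (carrier G) b = norm ((F \<star> X) s) powr (1/p)"
      unfolding ell_norm_def FX_real[OF s] by (simp add: pow cong: infsum_cong)
    have "norm ((f \<star> \<xi>) s) \<le> (\<Sum>\<^sub>\<infinity>t\<in>carrier G. norm (f t * \<xi> (inv t \<otimes> s)))"
      using s assms(1) unfolding convolve_def
      by (auto intro!: norm_infsum_bound conv_abs_summable[OF f norm_le_ell_norm[OF _ \<xi>]])
    also have "\<dots> = (\<Sum>\<^sub>\<infinity>t\<in>carrier G. norm (a t * b t))"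
    proof (rule infsum_cong)
      fix t assume t: "t \<in> carrier G"
      have "norm (f t) = norm (f t) powr (1/q) * norm (f t) powr (1/p)"
        using q(2) by (subst powr_add[symmetric]) (simp add: add.commute)
      then show "norm (f t * \<xi> (inv t \<otimes> s)) = norm (a t * b t)"
        using t by (simp add: a_def b_def norm_mult flip: mult.assoc)
    qed
    also have "\<dots> \<le> N powr (1/q) * norm ((F \<star> X) s) powr (1/p)"
      using Holder_inequality_ell(2)[OF assms(1), of a "carrier G" b] a b by (simp add: q_def b_norm)
    finally have "norm ((f \<star> \<xi>) s) powr p \<le> (N powr (1/q) * norm ((F \<star> X) s) powr (1/p)) powr p"
      using assms(1) by (intro powr_mono2) auto
    then show ?thesis
      using assms(1) by (simp add: powr_mult powr_powr)
  qed
  have dom: "(\<lambda>s. N powr (p/q) * norm ((F \<star> X) s)) summable_on carrier G"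
    using FX by (intro summable_on_cmult_right) (simp add: ell_1_iff)
  have summ: "(\<lambda>s. norm ((f \<star> \<xi>) s) powr p) summable_on carrier G"
    by (rule summable_on_comparison_test[OF dom]) (use pointwise in auto)
  then show "f \<star> \<xi> \<in> ell p (carrier G)"
    by (simp add: ell_def convolve_def)
  have infsum_F: "infsum F (carrier G) = complex_of_real (\<Sum>\<^sub>\<infinity>s\<in>carrier G. norm (f s))"
    and infsum_X: "infsum X (carrier G) = complex_of_real (\<Sum>\<^sub>\<infinity>s\<in>carrier G. norm (\<xi> s) powr p)"
    by (simp_all add: F_def X_def infsum_of_real_complex)
  have "complex_of_real (\<Sum>\<^sub>\<infinity>s\<in>carrier G. norm ((F \<star> X) s)) = infsum (F \<star> X) (carrier G)"
    unfolding infsum_of_real_complex[symmetric] by (rule infsum_cong) (simp add: FX_of_real[symmetric])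
  also have "\<dots> = complex_of_real (N * ell_norm p (carrier G) \<xi> powr p)"
    using assms(1) by (simp add: infsum_conv[OF F X] infsum_F infsum_X N_def ell_norm_1 ell_norm_powr)
  finally have FX_sum: "(\<Sum>\<^sub>\<infinity>s\<in>carrier G. norm ((F \<star> X) s)) = N * ell_norm p (carrier G) \<xi> powr p"
    by (simp only: of_real_eq_iff)
  have "0 \<le> N" by (simp add: N_def)
  have "p / q + 1 = p"
    using q assms(1) by (simp add: field_simps)
  have "(\<Sum>\<^sub>\<infinity>s\<in>carrier G. norm ((f \<star> \<xi>) s) powr p) \<le> (\<Sum>\<^sub>\<infinity>s\<in>carrier G. N powr (p/q) * norm ((F \<star> X) s))"
    by (rule infsum_mono[OF summ dom]) (rule pointwise)
  also have "\<dots> = N powr (p/q) * (N * ell_norm p (carrier G) \<xi> powr p)"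
    by (simp add: infsum_cmult_right' FX_sum)
  also have "\<dots> = N powr (p/q + 1) * ell_norm p (carrier G) \<xi> powr p"
    using \<open>0 \<le> N\<close> by (simp add: powr_add)
  also have "\<dots> = (N * ell_norm p (carrier G) \<xi>) powr p"
    using \<open>p / q + 1 = p\<close> \<open>0 \<le> N\<close> by (simp add: powr_mult)
  finally show "ell_norm p (carrier G) (f \<star> \<xi>) \<le> ell_norm 1 (carrier G) f * ell_norm p (carrier G) \<xi>"
    using assms(1) by (simp add: ell_norm_le_iff N_def)
qed

end

section \<open>Conjugacy classes and conjugation away from finite sets\<close>

context group begin

lemma cancel_inv_left [simp]: "a \<in> carrier G \<Longrightarrow> b \<in> carrier G \<Longrightarrow> inv a \<otimes> (a \<otimes> b) = b"
  and cancel_left_inv [simp]: "a \<in> carrier G \<Longrightarrow> b \<in> carrier G \<Longrightarrow> a \<otimes> (inv a \<otimes> b) = b"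
  by (simp_all add: m_assoc[symmetric])

lemma nat_pow_inj:
  assumes "y \<in> carrier G" "\<And>n::nat. 0 < n \<Longrightarrow> y [^] n \<noteq> \<one>"
  shows "inj (\<lambda>n::nat. y [^] n)"
proof (rule linorder_injI)
  fix i j :: nat assume "i < j"
  then obtain k where k: "j = i + k" "0 < k"
    using less_imp_add_positive by blast
  show "y [^] i \<noteq> y [^] j"
  proof
    assume "y [^] i = y [^] j"
    then have "inv (y [^] i) \<otimes> (y [^] i \<otimes> y [^] k) = inv (y [^] i) \<otimes> y [^] i"
      using assms(1) k(1) nat_pow_mult[of y i k] by simp
    then have "y [^] k = \<one>"
      using assms(1) by simp
    then show False
      using assms(2) k(2) by blast
  qed
qed

lemma nat_pow_commute:
  assumes "x \<in> carrier G" "y \<in> carrier G" "x \<otimes> y = y \<otimes> x"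
  shows "x [^] (n::nat) \<otimes> y = y \<otimes> x [^] n"
proof (induction n)
  case (Suc n)
  have "x [^] Suc n \<otimes> y = x [^] n \<otimes> (y \<otimes> x)"
    using assms by (simp add: m_assoc)
  also have "\<dots> = y \<otimes> x [^] Suc n"
    using assms Suc by (simp add: m_assoc[symmetric])
  finally show ?case .
qed (use assms in simp)

lemma nat_pow_conj:
  assumes "g \<in> carrier G" "x \<in> carrier G"
  shows "(g \<otimes> x \<otimes> inv g) [^] (n::nat) = g \<otimes> x [^] n \<otimes> inv g"
  using assms by (induction n) (simp_all add: m_assoc)

lemma conj_eq_iff:
  assumes "g \<in> carrier G" "a \<in> carrier G" "b \<in> carrier G"
  shows "g \<otimes> a \<otimes> inv g = g \<otimes> b \<otimes> inv g \<longleftrightarrow> a = b"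
proof
  assume "g \<otimes> a \<otimes> inv g = g \<otimes> b \<otimes> inv g"
  then have "inv g \<otimes> (g \<otimes> a \<otimes> inv g) \<otimes> g = inv g \<otimes> (g \<otimes> b \<otimes> inv g) \<otimes> g" by simp
  then show "a = b"
    using assms by (simp add: m_assoc)
qed simp

lemma conjugacy_class_subset: "x \<in> carrier G \<Longrightarrow> conjugacy_class G x \<subseteq> carrier G"
  by (auto simp: conjugacy_class_def)

lemma self_in_conjugacy_class: "x \<in> carrier G \<Longrightarrow> x \<in> conjugacy_class G x"
  unfolding conjugacy_class_def by (intro CollectI exI[of _ \<one>]) simp

lemma conj_in_conjugacy_class:
  assumes "x \<in> carrier G" "c \<in> conjugacy_class G x" "g \<in> carrier G"
  shows "g \<otimes> c \<otimes> inv g \<in> conjugacy_class G x"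
proof -
  obtain h where "h \<in> carrier G" "c = h \<otimes> x \<otimes> inv h"
    using assms(2) by (auto simp: conjugacy_class_def)
  then have "g \<otimes> c \<otimes> inv g = (g \<otimes> h) \<otimes> x \<otimes> inv (g \<otimes> h)" "g \<otimes> h \<in> carrier G"
    using assms by (simp_all add: m_assoc inv_mult_group)
  then show ?thesis
    unfolding conjugacy_class_def by blast
qed

lemma one_notin_conjugacy_class:
  assumes "x \<in> carrier G" "x \<noteq> \<one>"
  shows "\<one> \<notin> conjugacy_class G x"
proof
  assume "\<one> \<in> conjugacy_class G x"
  then obtain g where g: "g \<in> carrier G" "\<one> = g \<otimes> x \<otimes> inv g"
    by (auto simp: conjugacy_class_def)
  have "inv g \<otimes> (g \<otimes> x \<otimes> inv g) \<otimes> g = \<one>"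
    unfolding g(2)[symmetric] using g(1) by simp
  then show False
    using g(1) assms by (simp add: m_assoc)
qed

lemma conjugacy_class_one: "conjugacy_class G \<one> = {\<one>}"
  by (auto simp: conjugacy_class_def intro: exI[of _ \<one>])

lemma ICC_infinite:
  assumes "ICC G" "x \<in> carrier G" "x \<noteq> \<one>"
  shows "infinite (conjugacy_class G x)"
  using assms self_in_conjugacy_class[of x] by (auto simp: ICC_def)

text \<open>Induction on \<open>E\<close>. When \<open>s\<close> is added, the old set \<open>E\<close> is moved away not only from \<open>A\<close> but also from
  finitely many conjugates of \<open>A\<close>. If \<open>s\<close> then lands on some \<open>a\<close> in \<open>A\<close>, one more conjugation, by an
  element \<open>r a\<close> that moves \<open>a\<close> out of \<open>A\<close>, removes it, and the choice of the conjugates of \<open>A\<close> keeps the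
  old set outside.\<close>

theorem ICC_escape:
  assumes "ICC G" "finite E" "E \<subseteq> carrier G - {\<one>}" "finite A"
  shows "\<exists>t\<in>carrier G. \<forall>s\<in>E. inv t \<otimes> s \<otimes> t \<notin> A"
  using assms(2,3,4)
proof (induction E arbitrary: A rule: finite_induct)
  case (insert s E)
  have "\<exists>r\<in>carrier G. a \<in> carrier G - {\<one>} \<longrightarrow> inv r \<otimes> a \<otimes> r \<notin> A" for a
  proof (cases "a \<in> carrier G - {\<one>}")
    case True
    then have "\<not> conjugacy_class G a \<subseteq> A"
      using ICC_infinite[OF assms(1)] insert.prems(2) finite_subset by blast
    then obtain g where "g \<in> carrier G" "g \<otimes> a \<otimes> inv g \<notin> A"
      by (auto simp: conjugacy_class_def)
    then show ?thesis
      by (intro bexI[of _ "inv g"]) auto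
  qed (use one_closed in blast)
  then obtain r where r: "\<And>a. r a \<in> carrier G"
      "\<And>a. a \<in> carrier G - {\<one>} \<Longrightarrow> inv (r a) \<otimes> a \<otimes> r a \<notin> A"
    by metis
  \<comment> \<open>Avoiding \<open>A'\<close> keeps the elements of \<open>E\<close> outside \<open>A\<close> also after a further conjugation by \<open>r a\<close>.\<close>
  define A' where "A' = A \<union> (\<Union>a\<in>A. (\<lambda>b. r a \<otimes> b \<otimes> inv (r a)) ` A)"
  obtain t where t: "t \<in> carrier G" "\<And>e. e \<in> E \<Longrightarrow> inv t \<otimes> e \<otimes> t \<notin> A'"
    using insert.IH[of A'] insert.prems by (auto simp: A'_def)
  define a where "a = inv t \<otimes> s \<otimes> t"
  have a: "a \<in> carrier G" "a \<noteq> \<one>"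
  proof -
    show "a \<in> carrier G"
      using t insert.prems by (auto simp: a_def)
    have "t \<otimes> a \<otimes> inv t = s"
      using t insert.prems by (auto simp: a_def m_assoc)
    then show "a \<noteq> \<one>"
      using t insert.prems by auto
  qed
  show ?case
  proof (cases "a \<in> A")
    case True
    define u where "u = t \<otimes> r a"
    have u: "u \<in> carrier G" "inv u \<otimes> e \<otimes> u = inv (r a) \<otimes> (inv t \<otimes> e \<otimes> t) \<otimes> r a"
      if "e \<in> carrier G" for e
      using t(1) r(1)[of a] that by (simp_all add: u_def m_assoc inv_mult_group)
    have "inv u \<otimes> s \<otimes> u \<notin> A"
      using u(2)[of s] r(2)[of a] a insert.prems by (simp add: a_def)
    moreover have "inv u \<otimes> e \<otimes> u \<notin> A" if "e \<in> E" for e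
    proof
      assume "inv u \<otimes> e \<otimes> u \<in> A"
      then have "r a \<otimes> (inv u \<otimes> e \<otimes> u) \<otimes> inv (r a) \<in> A'"
        using True by (auto simp: A'_def)
      moreover have "r a \<otimes> (inv u \<otimes> e \<otimes> u) \<otimes> inv (r a) = inv t \<otimes> e \<otimes> t"
        using u(2)[of e] that t(1) r(1)[of a] insert.prems by (auto simp: m_assoc)
      ultimately show False
        using t(2)[OF that] by simp
    qed
    ultimately show ?thesis
      using u(1)[OF one_closed] by (intro bexI[of _ u]) auto
  next
    case False
    then show ?thesis
      using t by (intro bexI[of _ t]) (auto simp: a_def A'_def)
  qed
qed (use one_closed in blast)

section \<open>Finite normal sets of torsion elements\<close>

text \<open>Occurrences of \<open>c\<close> are moved to the front of the word; the letters that they pass are conjugated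
  and stay in \<open>C\<close>.\<close>

lemma word_collect:
  assumes C: "C \<subseteq> carrier G" "\<And>g c. g \<in> carrier G \<Longrightarrow> c \<in> C \<Longrightarrow> inv g \<otimes> c \<otimes> g \<in> C"
    and "c \<in> C" "set w \<subseteq> C" "j \<le> count_list w c"
  shows "\<exists>w'. set w' \<subseteq> C \<and> length w' + j = length w \<and>
    foldr (\<otimes>) w \<one> = c [^] j \<otimes> foldr (\<otimes>) w' \<one>"
  using assms(4,5)
proof (induction w arbitrary: j)
  case Nil
  then show ?case by (intro exI[of _ "[]"]) simp
next
  case (Cons d w)
  have wC: "foldr (\<otimes>) v \<one> \<in> carrier G" if "set v \<subseteq> C" for v
    using that C(1) by (induction v) auto
  have cd: "c \<in> carrier G" "d \<in> carrier G" "d \<in> C"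
    using C(1) assms(3) Cons.prems by auto
  show ?case
  proof (cases "d = c")
    case True
    show ?thesis
    proof (cases j)
      case 0
      then show ?thesis
        using Cons.prems wC[of "d # w"] by (intro exI[of _ "d # w"]) auto
    next
      case (Suc i)
      then obtain w' where w': "set w' \<subseteq> C" "length w' + i = length w"
          "foldr (\<otimes>) w \<one> = c [^] i \<otimes> foldr (\<otimes>) w' \<one>"
        using Cons.IH[of i] Cons.prems True by auto
      then show ?thesis
        using True Suc cd wC[OF w'(1)] nat_pow_Suc2[OF cd(1), of i]
        by (intro exI[of _ w']) (simp add: m_assoc[symmetric])
    qed
  next
    case False
    then obtain w' where w': "set w' \<subseteq> C" "length w' + j = length w"
        "foldr (\<otimes>) w \<one> = c [^] j \<otimes> foldr (\<otimes>) w' \<one>"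
      using Cons.IH[of j] Cons.prems by auto
    let ?d = "inv (c [^] j) \<otimes> d \<otimes> c [^] j"
    have "foldr (\<otimes>) (d # w) \<one> = c [^] j \<otimes> foldr (\<otimes>) (?d # w') \<one>"
      using w'(3) cd wC[OF w'(1)] by (simp add: m_assoc)
    moreover have "?d \<in> C"
      using cd by (intro C(2)) auto
    ultimately show ?thesis
      using w' by (intro exI[of _ "?d # w'"]) simp
  qed
qed

text \<open>In a word of length more than \<open>card C * r\<close> some letter occurs \<open>r\<close> times. Collecting these
  occurrences gives a factor \<open>c [^] r = \<one>\<close>, so the word can be shortened, and words of bounded length
  represent all products.\<close>

theorem Dietzmann:
  assumes C: "C \<subseteq> carrier G" "\<And>g c. g \<in> carrier G \<Longrightarrow> c \<in> C \<Longrightarrow> inv g \<otimes> c \<otimes> g \<in> C"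
    and "finite C" "0 < r" "\<And>c. c \<in> C \<Longrightarrow> c [^] (r::nat) = \<one>"
  obtains H where "finite H" "H \<subseteq> carrier G" "\<one> \<in> H" "\<And>c h. c \<in> C \<Longrightarrow> h \<in> H \<Longrightarrow> c \<otimes> h \<in> H"
proof
  let ?prod = "\<lambda>w. foldr (\<otimes>) w \<one>"
  let ?W = "{w. set w \<subseteq> C \<and> length w \<le> card C * r}"
  let ?H = "?prod ` {w. set w \<subseteq> C}"
  have wC: "?prod w \<in> carrier G" if "set w \<subseteq> C" for w
    using that C(1) by (induction w) auto
  have "?prod w \<in> ?prod ` ?W" if "set w \<subseteq> C" for w
    using that
  proof (induction "length w" arbitrary: w rule: less_induct)
    case less
    show ?case
    proof (cases "\<exists>c\<in>C. r \<le> count_list w c")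
      case True
      then obtain c w' where "c \<in> C" "set w' \<subseteq> C" "length w' + r = length w" "?prod w
          = c [^] r \<otimes> ?prod w'"
        using word_collect[OF C _ less.prems] by metis
      then show ?thesis
        using less.hyps[of w'] \<open>0 < r\<close> assms(5)[of c] wC[of w'] by simp
    next
      case False
      have "length w = (\<Sum>c\<in>C. count_list w c)"
        using sum_count_set[OF less.prems \<open>finite C\<close>] by simp
      also have "\<dots> \<le> (\<Sum>c\<in>C. r)"
        using False by (intro sum_mono) (simp add: not_le less_imp_le)
      finally show ?thesis
        using less.prems by auto
    qed
  qed
  then have "?H \<subseteq> ?prod ` ?W" by blast
  moreover have "finite ?W"
    using finite_lists_length_le[OF \<open>finite C\<close>] by simp
  ultimately show "finite ?H"
    using finite_subset by blast
  show "?H \<subseteq> carrier G" using wC by blast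
  show "\<one> \<in> ?H" by (rule image_eqI[of _ _ "[]"]) auto
  show "c \<otimes> h \<in> ?H" if ch: "c \<in> C" "h \<in> ?H" for c h
  proof -
    obtain w where "set w \<subseteq> C" "h = ?prod w" using ch(2) by blast
    then show ?thesis
      using ch(1) by (intro image_eqI[of _ _ "c # w"]) auto
  qed
qed

section \<open>Class functions with a zero divisor: the torsion case\<close>

definition class_function :: "('a \<Rightarrow> complex) \<Rightarrow> bool" where
  "class_function Q \<longleftrightarrow> (\<forall>g\<in>carrier G. \<forall>s\<in>carrier G. Q (g \<otimes> s \<otimes> inv g) = Q s)"

text \<open>If \<open>H\<close> is the finite set generated by the class \<open>C\<close> of \<open>x\<close>, then \<open>c H = H\<close> for each \<open>c\<close> in \<open>C\<close>: the
  indicator of \<open>H\<close> is fixed by every \<open>delta c\<close>.\<close>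

lemma zero_divisor_torsion:
  assumes x: "x \<in> carrier G" "x \<noteq> \<one>" "finite (conjugacy_class G x)" and r: "0 < r" "x [^] (r::nat) = \<one>"
  shows "\<exists>Q\<in>ell 1 (carrier G). \<exists>F\<in>ell 1 (carrier G). class_function Q \<and> Q \<noteq> 0 \<and> F \<noteq> 0 \<and> Q \<star> F = 0"
proof -
  define C where "C = conjugacy_class G x"
  have C: "C \<subseteq> carrier G" "finite C" "x \<in> C" "\<one> \<notin> C"
    using x conjugacy_class_subset self_in_conjugacy_class one_notin_conjugacy_class by (auto
        simp: C_def)
  have conj: "g \<otimes> c \<otimes> inv g \<in> C" if "g \<in> carrier G" "c \<in> C" for g c
    using that conj_in_conjugacy_class[OF x(1)] by (auto simp: C_def)
  have conj': "inv g \<otimes> c \<otimes> g \<in> C" if "g \<in> carrier G" "c \<in> C" for g c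
    using conj[of "inv g" c] that by simp
  have "c [^] r = \<one>" if "c \<in> C" for c
    using that x(1) r(2) by (auto simp: C_def conjugacy_class_def nat_pow_conj)
  then obtain H where H: "finite H" "H \<subseteq> carrier G" "\<one> \<in> H" "\<And>c h. c \<in> C \<Longrightarrow> h \<in> H \<Longrightarrow> c \<otimes> h \<in> H"
    using Dietzmann[OF C(1) conj' C(2) r(1)] by metis
  define F where "F = (\<lambda>s. if s \<in> H then 1 else 0 :: complex)"
  define Q where "Q = (\<lambda>s. if s = \<one> then of_nat (card C) else if s \<in> C then -1 else 0 :: complex)"
  have "F \<in> ell 1 (carrier G)"
    using H by (intro ell_finite_support[of H]) (auto simp: F_def)
  moreover have "Q \<in> ell 1 (carrier G)"
    using C by (intro ell_finite_support[of "insert \<one> C"]) (auto simp: Q_def)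
  moreover have "F \<one> \<noteq> 0" "Q x \<noteq> 0"
    using H(3) C(3,4) by (auto simp: F_def Q_def)
  then have "F \<noteq> 0" "Q \<noteq> 0"
    by auto
  moreover have "class_function Q"
    unfolding class_function_def
  proof (intro ballI)
    fix g s assume gs: "g \<in> carrier G" "s \<in> carrier G"
    have "inv g \<otimes> (g \<otimes> s \<otimes> inv g) \<otimes> g = s"
      using gs by (simp add: m_assoc)
    then have "g \<otimes> s \<otimes> inv g = \<one> \<longleftrightarrow> s = \<one>" "g \<otimes> s \<otimes> inv g \<in> C \<longleftrightarrow> s \<in> C"
      using gs conj[of g s] conj'[of g "g \<otimes> s \<otimes> inv g"] by auto
    then show "Q (g \<otimes> s \<otimes> inv g) = Q s"
      by (simp add: Q_def)
  qed
  moreover have "Q \<star> F = 0"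
  proof
    fix s
    show "(Q \<star> F) s = 0 s"
    proof (cases "s \<in> carrier G")
      case s: True
      have F_inv: "F (inv c \<otimes> s) = F s" if "c \<in> C" for c
      proof -
        have c: "c \<in> carrier G" using C(1) that by blast
        have "inj_on (\<lambda>h. c \<otimes> h) H"
          using c H(2) by (intro inj_onI) (metis cancel_inv_left subsetD)
        then have "(\<lambda>h. c \<otimes> h) ` H = H"
          using H(1,4) that by (intro card_subset_eq card_image) auto
        have "inv c \<otimes> s \<in> H \<longleftrightarrow> s \<in> H"
        proof
          assume "inv c \<otimes> s \<in> H"
          from H(4)[OF that this] show "s \<in> H"
            using c s by simp
        next
          assume "s \<in> H"
          then obtain h where "h \<in> H" "s = c \<otimes> h"
            using \<open>(\<lambda>h. c \<otimes> h) ` H = H\<close> by blast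
          then show "inv c \<otimes> s \<in> H"
            using c H(2) by auto
        qed
        then show ?thesis by (simp add: F_def)
      qed
      have "(Q \<star> F) s = (\<Sum>\<^sub>\<infinity>t\<in>carrier G. Q t * F (inv t \<otimes> s))"
        using s by (simp add: convolve_def)
      also have "\<dots> = (\<Sum>\<^sub>\<infinity>t\<in>insert \<one> C. Q t * F (inv t \<otimes> s))"
        by (rule infsum_cong_neutral) (use C in \<open>auto simp: Q_def\<close>)
      also have "\<dots> = of_nat (card C) * F s + (\<Sum>t\<in>C. Q t * F (inv t \<otimes> s))"
        using C s by (simp add: Q_def)
      also have "(\<Sum>t\<in>C. Q t * F (inv t \<otimes> s)) = (\<Sum>t\<in>C. - F s)"
        using C(4) F_inv by (intro sum.cong) (auto simp: Q_def)
      finally show ?thesis by simp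
    qed (simp add: convolve_def)
  qed
  ultimately show ?thesis by blast
qed

end

section \<open>Class functions with a zero divisor: the case of infinite order\<close>

text \<open>The alternating partial sums of the coefficients are the nonnegative numbers
  \<open>c n = (-1)\<^sup>n ((-1/2) gchoose n)\<close>, and from the second coefficient on the alternating terms have
  constant sign. So the absolute values telescope.\<close>

lemma summable_half_gbinomial: "summable (\<lambda>k. \<bar>(1/2 :: real) gchoose k\<bar>)"
proof -
  define c where "c n = (-1) ^ n * ((-1/2 :: real) gchoose n)" for n
  have c_nonneg: "0 \<le> c n" for n
  proof -
    have "c n = (\<Prod>i<n. (1/2 + real i) / real (n - i))"
    proof -
      have "(-1) ^ n = (\<Prod>i<n. -1 :: real)" by simp
      then have "c n = (\<Prod>i<n. - 1 * ((- 1/2 - real i) / real (n - i)))"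
        unfolding c_def gbinomial_altdef_of_nat lessThan_atLeast0 by (simp only: prod.distrib)
      also have "\<dots> = (\<Prod>i<n. (1/2 + real i) / real (n - i))"
        by (intro prod.cong refl) (simp add: field_simps)
      finally show ?thesis .
    qed
    also have "\<dots> \<ge> 0"
      by (intro prod_nonneg) auto
    finally show ?thesis .
  qed
  have partial: "(\<Sum>k\<le>n. ((1/2::real) gchoose k) * (-1) ^ k) = c n" for n
    using gbinomial_sum_lower_neg[of "1/2::real" n] by (simp add: c_def)
  have sign: "(-1) ^ Suc k * ((1/2::real) gchoose Suc k) = - (c k / (2 * real (Suc k)))" for k
    using gbinomial_absorption[of k "1/2::real"] by (simp add: c_def field_simps)
  have "\<bar>(1/2::real) gchoose Suc k\<bar> = c k - c (Suc k)" for k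
  proof -
    have "c (Suc k) - c k = (-1) ^ Suc k * ((1/2::real) gchoose Suc k)"
      unfolding partial[symmetric] by simp
    moreover have "\<bar>(1/2::real) gchoose Suc k\<bar> = \<bar>(-1) ^ Suc k * ((1/2::real) gchoose Suc k)\<bar>"
      by (simp only: abs_mult power_abs) simp
    moreover have "(-1) ^ Suc k * ((1/2::real) gchoose Suc k) \<le> 0"
      unfolding sign using c_nonneg[of k] by simp
    ultimately show ?thesis by linarith
  qed
  then have "(\<Sum>k<n. \<bar>(1/2::real) gchoose Suc k\<bar>) = c 0 - c n" for n
    by (simp add: sum_lessThan_telescope')
  then have "summable (\<lambda>k. \<bar>(1/2::real) gchoose Suc k\<bar>)"
    using c_nonneg by (intro bounded_imp_summable[of _ "c 0"]) (auto
        simp: lessThan_Suc_atMost[symmetric])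
  then show ?thesis
    by (subst summable_Suc_iff[symmetric])
qed

context group begin

text \<open>The binomial series of \<open>(1 + y)\<^bsup>1/2\<^esup>\<close> as a function on the group. Summing over the fibre of
  \<open>k \<mapsto> y [^] k\<close> avoids a choice of exponent and makes invariance under conjugation evident; for
  \<open>y\<close> of infinite order the fibres have at most one element.\<close>

definition sqrt_series :: "'a \<Rightarrow> 'a \<Rightarrow> complex" where
  "sqrt_series y = (\<lambda>g. \<Sum>\<^sub>\<infinity>k | y [^] (k::nat) = g. complex_of_real ((1/2) gchoose k))"

context
  fixes y assumes y: "y \<in> carrier G" "\<And>n::nat. 0 < n \<Longrightarrow> y [^] n \<noteq> \<one>"
begin

lemma sqrt_series_pow: "sqrt_series y (y [^] (k::nat)) = complex_of_real ((1/2) gchoose k)"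
proof -
  have "{j. y [^] j = y [^] k} = {k}"
    using nat_pow_inj[OF y] by (auto dest: injD)
  then show ?thesis
    by (simp add: sqrt_series_def)
qed

lemma sqrt_series_eq_0: "(\<And>k::nat. s \<noteq> y [^] k) \<Longrightarrow> sqrt_series y s = 0"
  by (simp add: sqrt_series_def eq_commute[of _ s])

lemma sqrt_series_in_ell_1: "sqrt_series y \<in> ell 1 (carrier G)"
proof -
  have "(\<lambda>k. \<bar>(1/2::real) gchoose k\<bar>) summable_on UNIV"
    using summable_half_gbinomial by (intro norm_summable_imp_summable_on) simp
  then have "(\<lambda>s. norm (sqrt_series y s)) summable_on range (\<lambda>k::nat. y [^] k)"
    using nat_pow_inj[OF y] by (subst summable_on_reindex) (auto simp: o_def sqrt_series_pow)
  then have "(\<lambda>s. norm (sqrt_series y s)) summable_on carrier G"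
    by (rule summable_on_cong_neutral[THEN iffD1, rotated -1]) (use y sqrt_series_eq_0 in auto)
  moreover have "sqrt_series y s = 0" if "s \<notin> carrier G" for s
    using that y by (intro sqrt_series_eq_0) auto
  ultimately show ?thesis
    by (simp add: ell_1_iff)
qed

lemma infsum_sqrt_series:
  "(\<Sum>\<^sub>\<infinity>s\<in>carrier G. sqrt_series y s * h s) =
    (\<Sum>\<^sub>\<infinity>k::nat. complex_of_real ((1/2) gchoose k) * h (y [^] k))"
proof -
  have "(\<Sum>\<^sub>\<infinity>s\<in>carrier G. sqrt_series y s * h s) = (\<Sum>\<^sub>\<infinity>s\<in>range (\<lambda>k::nat. y [^] k). sqrt_series y s
      * h s)"
    by (rule infsum_cong_neutral) (use y sqrt_series_eq_0 in auto)
  also have "\<dots> = (\<Sum>\<^sub>\<infinity>k::nat. complex_of_real ((1/2) gchoose k) * h (y [^] k))"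
    using nat_pow_inj[OF y] by (subst infsum_reindex) (auto simp: o_def sqrt_series_pow)
  finally show ?thesis .
qed

text \<open>Vandermonde's identity: the convolution of the sequence \<open>(1/2) gchoose k\<close> with itself is
  \<open>1 gchoose n\<close>.\<close>

lemma sqrt_series_squared: "sqrt_series y \<star> sqrt_series y = delta \<one> + delta y"
proof
  fix s
  let ?b = "\<lambda>k. complex_of_real ((1/2) gchoose k)"
  have conv: "(sqrt_series y \<star> sqrt_series y) s = (\<Sum>\<^sub>\<infinity>k::nat. ?b k * sqrt_series y (inv (y [^] k) \<otimes> s))"
    if "s \<in> carrier G"
    unfolding convolve_def using that infsum_sqrt_series[of "\<lambda>t. sqrt_series y (inv t \<otimes> s)"] by simp
  show "(sqrt_series y \<star> sqrt_series y) s = (delta \<one> + delta y) s"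
  proof (cases "\<exists>n::nat. s = y [^] n")
    case True
    then obtain n :: nat where n: "s = y [^] n" by blast
    have tm: "sqrt_series y (inv (y [^] k) \<otimes> s) = (if k \<le> n then ?b (n - k) else 0)" for k
    proof (cases "k \<le> n")
      case True
      then have "s = y [^] k \<otimes> y [^] (n - k)"
        using y n by (simp add: nat_pow_mult)
      then have "inv (y [^] k) \<otimes> s = y [^] (n - k)"
        using y by simp
      then show ?thesis
        using True by (simp add: sqrt_series_pow)
    next
      case False
      have "inv (y [^] k) \<otimes> s \<noteq> y [^] j" for j :: nat
      proof
        assume "inv (y [^] k) \<otimes> s = y [^] j"
        then have "y [^] k \<otimes> (inv (y [^] k) \<otimes> s) = y [^] k \<otimes> y [^] j" by simp
        then have "y [^] n = y [^] (k + j)"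
          using y n by (simp add: nat_pow_mult)
        then show False
          using nat_pow_inj[OF y] False by (auto dest!: injD)
      qed
      then show ?thesis
        using False sqrt_series_eq_0 by simp
    qed
    have sG: "s \<in> carrier G"
      using y n by simp
    have "(sqrt_series y \<star> sqrt_series y) s = (\<Sum>\<^sub>\<infinity>k\<in>{0..n}. ?b k * ?b (n - k))"
      unfolding conv[OF sG] tm by (rule infsum_cong_neutral) auto
    also have "\<dots> = complex_of_real (\<Sum>k\<in>{0..n}. ((1/2) gchoose k) * ((1/2) gchoose (n - k)))"
      by simp
    also have "\<dots> = complex_of_real ((1::real) gchoose n)"
      by (subst gbinomial_Vandermonde) simp
    also have "(1::real) gchoose n = (if n \<le> 1 then 1 else 0)"
      using binomial_gbinomial[of 1 n, where ?'a = real] by (cases n) (auto simp: binomial_eq_0)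
    also have "complex_of_real (if n \<le> 1 then 1 else 0) = (delta \<one> + delta y) s"
    proof -
      have "s = \<one> \<longleftrightarrow> n = 0" "s = y \<longleftrightarrow> n = 1"
        using n y injD[OF nat_pow_inj[OF y], of n 0] injD[OF nat_pow_inj[OF y], of n 1] by auto
      then show ?thesis
        by (auto simp: delta_def)
    qed
    finally show ?thesis .
  next
    case False
    then have "s \<noteq> y [^] (0::nat)" "s \<noteq> y [^] (1::nat)"
      by blast+
    then have "s \<noteq> \<one>" "s \<noteq> y"
      using y(1) by auto
    then have rhs: "(delta \<one> + delta y) s = 0"
      by (simp add: delta_def)
    show ?thesis
    proof (cases "s \<in> carrier G")
      case True
      have "sqrt_series y (inv (y [^] k) \<otimes> s) = 0" for k :: nat
      proof (rule sqrt_series_eq_0)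
        fix j :: nat
        show "inv (y [^] k) \<otimes> s \<noteq> y [^] j"
        proof
          assume "inv (y [^] k) \<otimes> s = y [^] j"
          then have "y [^] k \<otimes> (inv (y [^] k) \<otimes> s) = y [^] k \<otimes> y [^] j" by simp
          then have "s = y [^] (k + j)"
            using y True by (simp add: nat_pow_mult)
          then show False
            using False by blast
        qed
      qed
      then show ?thesis
        using conv[OF True] rhs by simp
    qed (use rhs in \<open>simp add: convolve_def\<close>)
  qed
qed

end

lemma conv_commute:
  assumes "\<And>s t. f s \<noteq> 0 \<Longrightarrow> g t \<noteq> 0 \<Longrightarrow> s \<in> carrier G \<Longrightarrow> t \<in> carrier G \<Longrightarrow> s \<otimes> t = t \<otimes> s"
  shows "f \<star> g = g \<star> f"
proof
  fix s
  show "(f \<star> g) s = (g \<star> f) s"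
  proof (cases "s \<in> carrier G")
    case s: True
    have "f t * g (inv t \<otimes> s) = g (s \<otimes> inv t) * f t" if t: "t \<in> carrier G" for t
    proof (cases "f t = 0")
      case False
      have "g (inv t \<otimes> s) \<noteq> 0 \<Longrightarrow> inv t \<otimes> s = s \<otimes> inv t"
      proof -
        assume "g (inv t \<otimes> s) \<noteq> 0"
        from assms[OF False this] s t have "s = inv t \<otimes> s \<otimes> t" by simp
        then have "s \<otimes> inv t = inv t \<otimes> s \<otimes> t \<otimes> inv t" by simp
        then show ?thesis using s t by (simp add: m_assoc)
      qed
      moreover have "g (s \<otimes> inv t) \<noteq> 0 \<Longrightarrow> inv t \<otimes> s = s \<otimes> inv t"
      proof -
        assume "g (s \<otimes> inv t) \<noteq> 0"
        from assms[OF False this] s t have "t \<otimes> (s \<otimes> inv t) = s" by (simp add: m_assoc)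
        then have "inv t \<otimes> s = inv t \<otimes> (t \<otimes> (s \<otimes> inv t))" by simp
        then show ?thesis using s t by simp
      qed
      ultimately show ?thesis by (metis mult.commute mult_zero_left)
    qed simp
    then show ?thesis
      using s by (simp only: conv_right_kernel[of s g f]) (auto simp: convolve_def intro: infsum_cong)
  qed (simp add: convolve_def)
qed

lemma ell_1_conv_add_left:
  "f \<in> ell 1 (carrier G) \<Longrightarrow> g \<in> ell 1 (carrier G) \<Longrightarrow> h \<in> ell 1 (carrier G) \<Longrightarrow> (f + g) \<star> h = f \<star> h + g \<star> h"
  by (rule conv_add_left[OF _ _ norm_le_ell_norm]) auto

lemma ell_1_conv_add_right:
  "f \<in> ell 1 (carrier G) \<Longrightarrow> g \<in> ell 1 (carrier G) \<Longrightarrow> h \<in> ell 1 (carrier G) \<Longrightarrow> f \<star> (g + h) = f \<star> g + f \<star> h"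
  by (rule conv_add_right[OF _ norm_le_ell_norm norm_le_ell_norm]) auto

lemma ell_1_conv_diff_left:
  assumes "f \<in> ell 1 (carrier G)" "g \<in> ell 1 (carrier G)" "h \<in> ell 1 (carrier G)"
  shows "(f - g) \<star> h = f \<star> h - g \<star> h"
  using ell_1_conv_add_left[of "f - g" g h] assms ell_diff[of 1 f
      "carrier G" g] by (simp add: algebra_simps)

lemma ell_1_conv_assoc:
  "f \<in> ell 1 (carrier G) \<Longrightarrow> g \<in> ell 1 (carrier G) \<Longrightarrow> h \<in> ell 1 (carrier G) \<Longrightarrow> (f \<star> g) \<star> h = f \<star> (g \<star> h)"
  by (rule conv_assoc[OF _ _ norm_le_ell_norm]) auto

text \<open>The two square roots \<open>(1 + x\<^sup>2)\<^bsup>1/2\<^esup>\<close> and \<open>x (1 + x\<^bsup>-2\<^esup>)\<^bsup>1/2\<^esup>\<close> of \<open>1 + x\<^sup>2\<close>, with only even and only odd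
  powers of \<open>x\<close>.\<close>

definition root_even :: "'a \<Rightarrow> 'a \<Rightarrow> complex" where
  "root_even x = sqrt_series (x [^] (2::nat))"

definition root_odd :: "'a \<Rightarrow> 'a \<Rightarrow> complex" where
  "root_odd x = delta x \<star> sqrt_series (inv (x [^] (2::nat)))"

text \<open>The supports lie in the group generated by \<open>x\<close>. Stated through commutation, this applies twice in
  a row: to \<open>x\<close> and then to an element commuting with \<open>x\<close>.\<close>

lemma root_support:
  assumes x: "x \<in> carrier G" and z: "z \<in> carrier G" "x \<otimes> z = z \<otimes> x"
    and s: "root_even x s \<noteq> 0 \<or> root_odd x s \<noteq> 0" "s \<in> carrier G"
  shows "s \<otimes> z = z \<otimes> s"
proof -
  let ?y = "x [^] (2::nat)"
  have y: "?y \<otimes> z = z \<otimes> ?y"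
    by (rule nat_pow_commute[OF x z])
  have y': "inv ?y \<otimes> z = z \<otimes> inv ?y"
  proof -
    have "inv ?y \<otimes> (z \<otimes> ?y) \<otimes> inv ?y = inv ?y \<otimes> (?y \<otimes> z) \<otimes> inv ?y"
      using y by simp
    then show ?thesis using x z(1) by (simp add: m_assoc)
  qed
  have support: "\<exists>k::nat. s = w [^] k" if "sqrt_series w s \<noteq> 0" for w s
  proof (rule ccontr)
    assume "\<nexists>k::nat. s = w [^] k"
    then have "{k::nat. w [^] k = s} = {}" by blast
    then show False
      using that by (simp add: sqrt_series_def)
  qed
  from s(1) show ?thesis
  proof
    assume "root_even x s \<noteq> 0"
    then obtain k :: nat where "s = ?y [^] k"
      using support unfolding root_even_def by blast
    then show ?thesis
      using nat_pow_commute[OF _ z(1) y] x by simp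
  next
    assume "root_odd x s \<noteq> 0"
    then obtain k :: nat where "inv x \<otimes> s = inv ?y [^] k"
      using support[of "inv ?y" "inv x \<otimes> s"] x s(2) by (auto simp: root_odd_def delta_conv)
    then have "x \<otimes> (inv x \<otimes> s) = x \<otimes> inv ?y [^] k" by simp
    then have "s = x \<otimes> inv ?y [^] k"
      using x s(2) by simp
    moreover have "inv ?y [^] k \<otimes> z = z \<otimes> inv ?y [^] k"
      using nat_pow_commute[OF _ z(1) y'] x by simp
    ultimately show ?thesis
      using x z by (simp add: m_assoc) (simp add: m_assoc[symmetric])
  qed
qed

lemma conj_nat_pow_eq_iff:
  assumes "g \<in> carrier G" "y \<in> carrier G" "s \<in> carrier G"
  shows "(g \<otimes> y \<otimes> inv g) [^] (k::nat) = g \<otimes> s \<otimes> inv g \<longleftrightarrow> y [^] k = s"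
  using assms by (simp add: nat_pow_conj conj_eq_iff)

lemma root_conj:
  assumes "g \<in> carrier G" "x \<in> carrier G" "s \<in> carrier G"
  shows "root_even (g \<otimes> x \<otimes> inv g) (g \<otimes> s \<otimes> inv g) = root_even x s"
    and "root_odd (g \<otimes> x \<otimes> inv g) (g \<otimes> s \<otimes> inv g) = root_odd x s"
proof -
  have sq: "sqrt_series (g \<otimes> y \<otimes> inv g) (g \<otimes> s \<otimes> inv g) = sqrt_series y s"
    if "y \<in> carrier G" "s \<in> carrier G" for y s
    unfolding sqrt_series_def using conj_nat_pow_eq_iff[OF assms(1) that] by simp
  show "root_even (g \<otimes> x \<otimes> inv g) (g \<otimes> s \<otimes> inv g) = root_even x s"
    using assms by (simp only: root_even_def nat_pow_conj sq nat_pow_closed)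
  have 1: "inv (g \<otimes> x [^] (2::nat) \<otimes> inv g) = g \<otimes> inv (x [^] (2::nat)) \<otimes> inv g"
    using assms by (simp add: inv_mult_group m_assoc)
  have 2: "inv (g \<otimes> x \<otimes> inv g) \<otimes> (g \<otimes> s \<otimes> inv g) = g \<otimes> (inv x \<otimes> s) \<otimes> inv g"
    using assms by (simp add: inv_mult_group m_assoc)
  show "root_odd (g \<otimes> x \<otimes> inv g) (g \<otimes> s \<otimes> inv g) = root_odd x s"
    using assms sq[of "inv (x [^] (2::nat))" "inv x \<otimes> s"]
    by (simp add: root_odd_def delta_conv nat_pow_conj 1 2)
qed

lemma infsum_delta: "t \<in> carrier G \<Longrightarrow> infsum (delta t) (carrier G) = 1"
  using infsum_cong_neutral[of "{t}" "carrier G" "\<lambda>_. 1" "delta t"] by (auto simp: delta_def)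

context
  fixes x assumes x: "x \<in> carrier G" "\<And>n::nat. 0 < n \<Longrightarrow> x [^] n \<noteq> \<one>"
begin

lemma square_infinite_order: "0 < n \<Longrightarrow> (x [^] (2::nat)) [^] (n::nat) \<noteq> \<one>"
  using x by (simp add: nat_pow_pow)

lemma inv_square_infinite_order: "0 < n \<Longrightarrow> inv (x [^] (2::nat)) [^] (n::nat) \<noteq> \<one>"
  using x square_infinite_order[of n] by (simp add: nat_pow_inv)

lemma inv_square_closed: "x [^] (2::nat) \<in> carrier G" "inv (x [^] (2::nat)) \<in> carrier G"
  using x by auto

lemmas even_series = sqrt_series_in_ell_1[OF inv_square_closed(1) square_infinite_order]
  sqrt_series_squared[OF inv_square_closed(1) square_infinite_order]
  infsum_sqrt_series[OF inv_square_closed(1) square_infinite_order, where h = "\<lambda>_. 1", simplified]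

lemmas odd_series = sqrt_series_in_ell_1[OF inv_square_closed(2) inv_square_infinite_order]
  sqrt_series_squared[OF inv_square_closed(2) inv_square_infinite_order]
  infsum_sqrt_series[OF inv_square_closed(2) inv_square_infinite_order, where h = "\<lambda>_. 1", simplified]

lemma root_even_in_ell_1: "root_even x \<in> ell 1 (carrier G)"
  unfolding root_even_def by (rule even_series)

lemma root_odd_in_ell_1: "root_odd x \<in> ell 1 (carrier G)"
  unfolding root_odd_def using x by (intro conv_in_ell_1 odd_series) auto

lemma root_odd_squared: "root_odd x \<star> root_odd x = root_even x \<star> root_even x"
proof -
  let ?y = "x [^] (2::nat)" and ?d = "delta x"
  let ?R = "sqrt_series (inv ?y)"
  have d: "?d \<in> ell 1 (carrier G)" "?R \<in> ell 1 (carrier G)"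
    using x odd_series by auto
  have comm: "?R \<star> ?d = ?d \<star> ?R"
  proof (rule conv_commute)
    fix s t assume s: "?R s \<noteq> 0" "?d t \<noteq> 0" "s \<in> carrier G" "t \<in> carrier G"
    then have t: "t = x" by (auto simp: delta_def split: if_splits)
    have "root_odd x (x \<otimes> s) \<noteq> 0"
      using s x by (simp add: root_odd_def delta_conv)
    then have "(x \<otimes> s) \<otimes> x = x \<otimes> (x \<otimes> s)"
      using x(1) s(3) by (intro root_support[OF x(1) x(1) refl]) simp_all
    then show "s \<otimes> t = t \<otimes> s"
      using x(1) s(3) t cancel_inv_left[of x "s \<otimes> x"] cancel_inv_left[of x "x \<otimes> s"]
      by (simp add: m_assoc)
  qed
  have "root_odd x \<star> root_odd x = ?d \<star> ((?R \<star> ?d) \<star> ?R)"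
    using d by (simp add: root_odd_def ell_1_conv_assoc conv_in_ell_1)
  also have "\<dots> = (?d \<star> ?d) \<star> (?R \<star> ?R)"
    unfolding comm using d by (simp add: ell_1_conv_assoc conv_in_ell_1)
  also have "\<dots> = delta ?y \<star> (delta \<one> + delta (inv ?y))"
    using x odd_series by (simp add: delta_conv_delta numeral_2_eq_2)
  also have "\<dots> = delta \<one> + delta ?y"
    using x by (simp add: ell_1_conv_add_right delta_conv_delta add.commute del: nat_pow_Suc)
  also have "\<dots> = root_even x \<star> root_even x"
    using even_series by (simp add: root_even_def)
  finally show ?thesis .
qed

lemma root_product_zero: "(root_even x - root_odd x) \<star> (root_even x + root_odd x) = 0"
proof -
  have comm: "root_even x \<star> root_odd x = root_odd x \<star> root_even x"
  proof (rule conv_commute)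
    fix s t assume s: "root_even x s \<noteq> 0" "root_odd x t \<noteq> 0" "s \<in> carrier G" "t \<in> carrier G"
    have "s \<otimes> x = x \<otimes> s"
      by (rule root_support[OF x(1) x(1) refl disjI1[OF s(1)] s(3)])
    from root_support[OF x(1) s(3) this[symmetric] disjI2[OF s(2)] s(4)]
    show "s \<otimes> t = t \<otimes> s" by (rule sym)
  qed
  show ?thesis
    using root_even_in_ell_1 root_odd_in_ell_1
    by (simp add: ell_1_conv_diff_left ell_1_conv_add_right ell_add comm root_odd_squared)
qed

text \<open>Both roots have the same coefficient sum \<open>\<beta>\<close>, and \<open>\<beta>\<^sup>2\<close> is the coefficient sum \<open>2\<close> of
  \<open>1 + x\<^sup>2\<close>.\<close>

lemma root_sum_infsum: "infsum (root_even x + root_odd x) (carrier G) \<noteq> 0"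
proof -
  let ?\<beta> = "infsum (root_even x) (carrier G)"
  have "?\<beta> * ?\<beta> = infsum (delta \<one> + delta (x [^] (2::nat))) (carrier G)"
    unfolding infsum_conv[OF root_even_in_ell_1 root_even_in_ell_1, symmetric]
    using even_series by (simp add: root_even_def)
  also have "\<dots> = infsum (delta \<one>) (carrier G) + infsum (delta (x [^] (2::nat))) (carrier G)"
    unfolding plus_fun_def using x by (intro infsum_add ell_1_summable) auto
  also have "\<dots> = 2"
    using x by (simp add: infsum_delta)
  finally have "?\<beta> \<noteq> 0" by auto
  moreover have "infsum (root_odd x) (carrier G) = ?\<beta>"
    using x odd_series even_series by (simp add: root_odd_def root_even_def infsum_conv infsum_delta)
  moreover have "infsum (root_even x + root_odd x) (carrier G) = ?\<beta> + infsum (root_odd x) (carrier G)"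
    unfolding plus_fun_def by (intro infsum_add ell_1_summable root_even_in_ell_1 root_odd_in_ell_1)
  ultimately show ?thesis by simp
qed

text \<open>The odd root has no term at \<open>\<one>\<close>, as \<open>x\<close> has infinite order.\<close>

lemma root_difference_at_one: "(root_even x - root_odd x) \<one> = 1"
proof -
  let ?y = "x [^] (2::nat)"
  have "root_even x \<one> = 1"
    using sqrt_series_pow[OF inv_square_closed(1) square_infinite_order, of 0] by (simp add:
        root_even_def)
  moreover have "root_odd x \<one> = 0"
  proof -
    have "inv x \<noteq> inv ?y [^] k" for k :: nat
    proof
      assume "inv x = inv ?y [^] k"
      then have "inv x = inv (x [^] (2 * k))"
        using x by (simp add: nat_pow_inv[symmetric] nat_pow_pow)
      then have "inv (inv x) = inv (inv (x [^] (2 * k)))" by simp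
      then have "x [^] (1::nat) = x [^] (2 * k)"
        using x(1) by simp
      then have "1 = 2 * k"
        using injD[OF nat_pow_inj[OF x], of 1 "2 * k"] by blast
      then show False by presburger
    qed
    then show ?thesis
      using x sqrt_series_eq_0[OF inv_square_closed(2) inv_square_infinite_order, of "inv x"]
      by (simp add: root_odd_def delta_conv)
  qed
  ultimately show ?thesis by simp
qed

end

text \<open>The function \<open>F\<close> is the product of all \<open>root_even y + root_odd y\<close>. The factors commute, and each
  \<open>root_even y - root_odd y\<close> kills its own factor. The coefficient sum is carried along to see that
  the product does not vanish.\<close>

lemma common_annihilator:
  assumes "finite D" "D \<subseteq> carrier G" "\<And>y n. y \<in> D \<Longrightarrow> 0 < (n::nat) \<Longrightarrow> y [^] n \<noteq> \<one>"
    and "\<And>y z. y \<in> D \<Longrightarrow> z \<in> D \<Longrightarrow> y \<otimes> z = z \<otimes> y"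
  shows "\<exists>F\<in>ell 1 (carrier G). infsum F (carrier G) \<noteq> 0 \<and> (\<forall>y\<in>D. (root_even y - root_odd y) \<star> F = 0)"
  using assms
proof (induction D rule: finite_induct)
  case empty
  then show ?case
    using infsum_delta[of \<one>] by (intro bexI[of _ "delta \<one>"]) auto
next
  case (insert y D)
  have "\<exists>F\<in>ell 1 (carrier G). infsum F (carrier G) \<noteq> 0 \<and> (\<forall>y\<in>D. (root_even y - root_odd y) \<star> F = 0)"
    by (rule insert.IH) (use insert.prems in blast)+
  then obtain F where F: "F \<in> ell 1 (carrier G)" "infsum F (carrier G) \<noteq> 0"
      "\<And>z. z \<in> D \<Longrightarrow> (root_even z - root_odd z) \<star> F = 0"
    by blast
  have in_ell: "root_even z + root_odd z \<in> ell 1 (carrier G)"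
      "root_even z - root_odd z \<in> ell 1 (carrier G)"
    if "z \<in> insert y D" for z
  proof -
    have "z \<in> carrier G" "\<And>n::nat. 0 < n \<Longrightarrow> z [^] n \<noteq> \<one>"
      using insert.prems(1,2) that by blast+
    from root_even_in_ell_1[OF this] root_odd_in_ell_1[OF this]
    show "root_even z + root_odd z \<in> ell 1 (carrier G)" "root_even z - root_odd z \<in> ell 1 (carrier G)"
      by (simp_all only: ell_add ell_diff zero_less_one)
  qed
  let ?P = "root_even y + root_odd y"
  have "?P \<star> F \<in> ell 1 (carrier G)"
    by (intro conv_in_ell_1 in_ell F) simp
  moreover have "infsum (?P \<star> F) (carrier G) \<noteq> 0"
  proof -
    have "infsum ?P (carrier G) \<noteq> 0"
      by (rule root_sum_infsum) (use insert.prems in blast)+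
    then show ?thesis
      unfolding infsum_conv[OF in_ell(1)[OF insertI1] F(1)] using F(2) by simp
  qed
  moreover have "(root_even z - root_odd z) \<star> (?P \<star> F) = 0" if z: "z \<in> insert y D" for z
  proof -
    let ?N = "root_even z - root_odd z"
    have comm: "?N \<star> ?P = ?P \<star> ?N"
    proof (rule conv_commute)
      fix s t assume s: "?N s \<noteq> 0" "?P t \<noteq> 0" "s \<in> carrier G" "t \<in> carrier G"
      have car: "y \<in> carrier G" "z \<in> carrier G"
        using z insert.prems(1) by auto
      have supp: "root_even z s \<noteq> 0 \<or> root_odd z s \<noteq> 0" "root_even y t \<noteq> 0 \<or> root_odd y t \<noteq> 0"
        using s(1,2) by auto
      have "z \<otimes> y = y \<otimes> z"
        using z by (intro insert.prems(3)) auto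
      from root_support[OF car(2,1) this supp(1) s(3)]
      have "s \<otimes> y = y \<otimes> s" .
      from root_support[OF car(1) s(3) this[symmetric] supp(2) s(4)]
      show "s \<otimes> t = t \<otimes> s" by (rule sym)
    qed
    show ?thesis
    proof (cases "z = y")
      case True
      have "?N \<star> ?P = 0"
        unfolding True by (rule root_product_zero) (use insert.prems in blast)+
      then show ?thesis
        unfolding ell_1_conv_assoc[OF in_ell(2)[OF z] in_ell(1)[OF insertI1] F(1), symmetric]
        by (simp only: conv_zero_left)
    next
      case False
      then have "z \<in> D" using z by simp
      have "?N \<star> (?P \<star> F) = (?N \<star> ?P) \<star> F"
        by (rule ell_1_conv_assoc[OF in_ell(2)[OF z] in_ell(1)[OF insertI1] F(1), symmetric])
      also have "\<dots> = ?P \<star> (?N \<star> F)"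
        unfolding comm by (rule ell_1_conv_assoc[OF in_ell(1)[OF insertI1] in_ell(2)[OF z] F(1)])
      finally show ?thesis
        by (simp only: F(3)[OF \<open>z \<in> D\<close>] conv_zero_right)
    qed
  qed
  ultimately show ?case by blast
qed

text \<open>Conjugation by powers of \<open>x\<close> permutes the finite class \<open>C\<close> of \<open>x\<close>, so two powers act in the same way
  and some \<open>y = x [^] k\<close> with \<open>k > 0\<close> commutes with \<open>C\<close>. The conjugates of \<open>y\<close> are \<open>k\<close>-th powers of
  elements of \<open>C\<close> and commute with \<open>C\<close>, hence with each other.\<close>

lemma zero_divisor_infinite_order:
  assumes x: "x \<in> carrier G" "finite (conjugacy_class G x)" "\<And>n. 0 < (n::nat) \<Longrightarrow> x [^] n \<noteq> \<one>"
  shows "\<exists>Q\<in>ell 1 (carrier G). \<exists>F\<in>ell 1 (carrier G). class_function Q \<and> Q \<noteq> 0 \<and> F \<noteq> 0 \<and> Q \<star> F = 0"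
proof -
  define C where "C = conjugacy_class G x"
  have C: "C \<subseteq> carrier G" "finite C"
    using x conjugacy_class_subset by (auto simp: C_def)
  have conj: "g \<otimes> c \<otimes> inv g \<in> C" if "g \<in> carrier G" "c \<in> C" for g c
    using that conj_in_conjugacy_class[OF x(1)] by (auto simp: C_def)
  obtain k :: nat where k: "0 < k" "\<And>c. c \<in> C \<Longrightarrow> x [^] k \<otimes> c = c \<otimes> x [^] k"
  proof -
    \<comment> \<open>There are only finitely many permutations of \<open>C\<close>.\<close>
    let ?f = "\<lambda>i::nat. \<lambda>c\<in>C. x [^] i \<otimes> c \<otimes> inv (x [^] i)"
    have "range ?f \<subseteq> C \<rightarrow>\<^sub>E C"
      using conj x(1) by auto
    moreover have "finite (C \<rightarrow>\<^sub>E C)"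
      using C(2) by (intro finite_PiE)
    ultimately have "finite (range ?f)"
      by (rule finite_subset)
    then have "\<not> inj ?f"
      using finite_imageD[of ?f UNIV] infinite_UNIV_nat by blast
    then obtain i j where "i < j" and ij: "?f i = ?f j"
      using linorder_injI[of ?f] by blast
    then obtain k where k: "j = i + k" "0 < k"
      using less_imp_add_positive by blast
    have "x [^] k \<otimes> c = c \<otimes> x [^] k" if c: "c \<in> C" for c
    proof -
      have "c \<in> carrier G" using C(1) c by blast
      note car = this x(1)
      have "x [^] i \<otimes> c \<otimes> inv (x [^] i) = x [^] j \<otimes> c \<otimes> inv (x [^] j)"
        using fun_cong[OF ij, of c] c by simp
      also have "x [^] j = x [^] i \<otimes> x [^] k"
        using car k(1) by (simp add: nat_pow_mult)
      also have "x [^] i \<otimes> x [^] k \<otimes> c \<otimes> inv (x [^] i \<otimes> x [^] k)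
          = x [^] i \<otimes> (x [^] k \<otimes> c \<otimes> inv (x [^] k)) \<otimes> inv (x [^] i)"
        using car by (simp add: inv_mult_group m_assoc)
      finally have "c = x [^] k \<otimes> c \<otimes> inv (x [^] k)"
        using car by (subst (asm) conj_eq_iff) auto
      then have "c \<otimes> x [^] k = x [^] k \<otimes> c \<otimes> inv (x [^] k) \<otimes> x [^] k" by simp
      then show ?thesis
        using car by (simp add: m_assoc)
    qed
    then show thesis
      using that k(2) by blast
  qed
  define y where "y = x [^] k"
  define D where "D = conjugacy_class G y"
  have y: "y \<in> carrier G" using x(1) by (simp add: y_def)
  have D: "D \<subseteq> carrier G" "y \<in> D"
    using y conjugacy_class_subset self_in_conjugacy_class by (auto simp: D_def)
  have D_pow: "d \<in> (\<lambda>c. c [^] k) ` C" if "d \<in> D" for d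
  proof -
    obtain g where "g \<in> carrier G" "d = g \<otimes> y \<otimes> inv g"
      using \<open>d \<in> D\<close> by (auto simp: D_def conjugacy_class_def)
    then have "d = (g \<otimes> x \<otimes> inv g) [^] k" "g \<otimes> x \<otimes> inv g \<in> C"
      using x(1) by (auto simp: nat_pow_conj y_def C_def conjugacy_class_def)
    then show ?thesis by blast
  qed
  then have "finite D"
    by (intro finite_surj[OF C(2)] subsetI)
  have comm: "d \<otimes> e = e \<otimes> d" if d: "d \<in> D" "e \<in> D" for d e
  proof -
    obtain g where g: "g \<in> carrier G" "d = g \<otimes> y \<otimes> inv g"
      using d(1) by (auto simp: D_def conjugacy_class_def)
    obtain c where c: "c \<in> C" "e = c [^] k"
      using D_pow[OF d(2)] by blast
    have cG: "c \<in> carrier G" using c C by blast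
    let ?c = "inv g \<otimes> c \<otimes> g"
    have "y \<otimes> ?c = ?c \<otimes> y"
      using k(2)[of ?c] conj[of "inv g" c] g(1) c(1) by (simp add: y_def)
    then have "g \<otimes> (y \<otimes> ?c) \<otimes> inv g = g \<otimes> (?c \<otimes> y) \<otimes> inv g" by simp
    then have "c \<otimes> d = d \<otimes> c"
      using g cG y by (simp add: m_assoc)
    then show ?thesis
      using nat_pow_commute[of c d k] cG D d c(2) by auto
  qed
  have order: "d [^] n \<noteq> \<one>" if dn: "d \<in> D" "0 < n" for d and n :: nat
  proof
    assume "d [^] n = \<one>"
    moreover obtain g where g: "g \<in> carrier G" "d = g \<otimes> y \<otimes> inv g"
      using dn(1) by (auto simp: D_def conjugacy_class_def)
    ultimately have "g \<otimes> y [^] n \<otimes> inv g = g \<otimes> \<one> \<otimes> inv g"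
      using y by (simp add: nat_pow_conj)
    then have "x [^] (k * n) = \<one>"
      using g(1) y x(1) by (subst (asm) conj_eq_iff) (auto simp: y_def nat_pow_pow)
    then show False
      using x(3)[of "k * n"] k(1) dn(2) by simp
  qed
  obtain F where F: "F \<in> ell 1 (carrier G)" "infsum F (carrier G) \<noteq> 0"
      "\<And>d. d \<in> D \<Longrightarrow> (root_even d - root_odd d) \<star> F = 0"
    using common_annihilator[OF \<open>finite D\<close> D(1) order comm] by blast
  define N where "N d = root_even d - root_odd d" for d
  define Q where "Q = (\<Sum>d\<in>D. N d)"
  have N: "N d \<in> ell 1 (carrier G)" if "d \<in> D" for d
    unfolding N_def
    by (intro ell_diff root_even_in_ell_1 root_odd_in_ell_1 order[OF that]) (use that D(1) in auto)
  have Q_apply: "Q s = (\<Sum>d\<in>D. N d s)" for s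
    unfolding Q_def by (induction D rule: infinite_finite_induct) auto
  have "(\<Sum>d\<in>E. N d) \<in> ell 1 (carrier G) \<and> (\<Sum>d\<in>E. N d) \<star> F = 0" if "finite E" "E \<subseteq> D" for E
    using that
  proof (induction E rule: finite_induct)
    case (insert d E)
    then have d: "d \<in> D" and E: "(\<Sum>d\<in>E. N d) \<in> ell 1 (carrier G)" "(\<Sum>d\<in>E. N d) \<star> F = 0"
      by blast+
    have "N d + (\<Sum>d\<in>E. N d) \<in> ell 1 (carrier G)"
      by (intro ell_add N d E) simp
    moreover have "(N d + (\<Sum>d\<in>E. N d)) \<star> F = N d \<star> F + (\<Sum>d\<in>E. N d) \<star> F"
      by (rule ell_1_conv_add_left[OF N[OF d] E(1) F(1)])
    then have "(N d + (\<Sum>d\<in>E. N d)) \<star> F = 0"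
      unfolding E(2) F(3)[OF d, folded N_def] by (simp only: add_0)
    ultimately show ?case
      unfolding sum.insert[OF insert.hyps] ..
  qed (simp only: sum.empty ell_zero conv_zero_left simp_thms)
  from this[OF \<open>finite D\<close> subset_refl] have "Q \<in> ell 1 (carrier G)" "Q \<star> F = 0"
    unfolding Q_def by blast+
  moreover have "Q \<one> = of_nat (card D)"
    unfolding Q_apply using root_difference_at_one D order by (simp add: N_def subset_iff)
  then have "Q \<noteq> 0"
    using \<open>finite D\<close> D(2) by auto
  moreover have "class_function Q"
    unfolding class_function_def
  proof (intro ballI)
    fix g s assume g: "g \<in> carrier G" "s \<in> carrier G"
    have "Q s = (\<Sum>d\<in>D. N (g \<otimes> d \<otimes> inv g) (g \<otimes> s \<otimes> inv g))"
      unfolding Q_apply using D(1) g by (intro sum.cong) (auto simp: N_def root_conj)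
    also have "\<dots> = (\<Sum>d\<in>D. N d (g \<otimes> s \<otimes> inv g))"
    proof (rule sum.reindex_bij_betw, rule bij_betwI[where g = "\<lambda>d. inv g \<otimes> d \<otimes> g"])
      show "(\<lambda>d. g \<otimes> d \<otimes> inv g) \<in> D \<rightarrow> D"
        using conj_in_conjugacy_class[OF y] g by (auto simp: D_def)
      show "(\<lambda>d. inv g \<otimes> d \<otimes> g) \<in> D \<rightarrow> D"
        using conj_in_conjugacy_class[OF y, of _ "inv g"] g by (auto simp: D_def)
    qed (use D(1) g in \<open>auto simp: m_assoc subset_iff\<close>)
    finally show "Q (g \<otimes> s \<otimes> inv g) = Q s"
      by (simp add: Q_apply)
  qed
  moreover have "F \<noteq> 0"
    using F(2) by (auto simp: zero_fun_def)
  ultimately show ?thesis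
    using F(1) by blast
qed

theorem zero_divisor_if_not_ICC:
  assumes "\<not> ICC G"
  obtains Q F where "Q \<in> ell 1 (carrier G)" "F \<in> ell 1 (carrier G)" "class_function Q"
    "Q \<noteq> 0" "F \<noteq> 0" "Q \<star> F = 0"
proof -
  obtain x where x: "x \<in> carrier G" "conjugacy_class G x \<noteq> {\<one>}" "finite (conjugacy_class G x)"
    using assms by (auto simp: ICC_def)
  then have "x \<noteq> \<one>"
    using conjugacy_class_one by auto
  with x show ?thesis
    using zero_divisor_torsion[of x] zero_divisor_infinite_order[of x] that by metis
qed

end

section \<open>Convolution operators and the commutant of the right translations\<close>

context group begin

definition conv_op :: "real \<Rightarrow> ('a \<Rightarrow> complex) \<Rightarrow> 'a operator" where
  "conv_op p f = (\<lambda>\<xi>. if \<xi> \<in> ell p (carrier G) then f \<star> \<xi> else 0)"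

lemma conv_op_bounded:
  assumes "1 < p" "f \<in> ell 1 (carrier G)"
  shows "conv_op p f \<in> bounded_ops p (carrier G)"
    and "\<xi> \<in> ell p (carrier G) \<Longrightarrow>
      ell_norm p (carrier G) (conv_op p f \<xi>) \<le> ell_norm 1 (carrier G) f * ell_norm p (carrier G) \<xi>"
proof -
  note Y = Young_inequality_conv[OF assms]
  have p: "0 < p" using assms(1) by simp
  have add: "f \<star> (\<xi> + \<eta>) = f \<star> \<xi> + f \<star> \<eta>" if "\<xi> \<in> ell p (carrier G)" "\<eta> \<in> ell p (carrier G)" for \<xi> \<eta>
    by (rule conv_add_right[OF assms(2) norm_le_ell_norm[OF p that(1)] norm_le_ell_norm[OF p that(2)]])
  show "conv_op p f \<in> bounded_ops p (carrier G)"
    unfolding bounded_ops_def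
    using Y by (auto simp: conv_op_def ell_add ell_scale p add conv_scale_right)
  show "ell_norm p (carrier G) (conv_op p f \<xi>) \<le> ell_norm 1 (carrier G) f * ell_norm p (carrier G) \<xi>"
    if "\<xi> \<in> ell p (carrier G)"
    using Y that by (simp add: conv_op_def)
qed

lemma conv_op_delta: "r \<in> carrier G \<Longrightarrow> conv_op p f (delta r) = f \<star> delta r"
  by (simp add: conv_op_def)

lemma left_regular_eq_conv_op: "t \<in> carrier G \<Longrightarrow> left_regular p G t = conv_op p (delta t)"
  by (auto simp: left_regular_def conv_op_def delta_conv fun_eq_iff)

lemma ell_norm_1_delta: "t \<in> carrier G \<Longrightarrow> ell_norm 1 (carrier G) (delta t) = 1"
  using infsum_cong_neutral[of "{t}" "carrier G" "\<lambda>_. 1 :: real" "\<lambda>s. norm (delta t s)"]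
  by (auto simp: ell_norm_1 delta_def)

lemma left_regular_bounded:
  assumes "1 < p" "t \<in> carrier G"
  shows "left_regular p G t \<in> bounded_ops p (carrier G)"
    and "\<xi> \<in> ell p (carrier G) \<Longrightarrow> ell_norm p (carrier G) (left_regular p G t \<xi>)
        \<le> ell_norm p (carrier G) \<xi>"
proof -
  have "delta t \<in> ell 1 (carrier G)"
    using assms(2) by simp
  note B = conv_op_bounded[OF assms(1) this]
  show "left_regular p G t \<in> bounded_ops p (carrier G)"
    using B(1) assms(2) by (simp add: left_regular_eq_conv_op)
  show "ell_norm p (carrier G) (left_regular p G t \<xi>) \<le> ell_norm p (carrier G) \<xi>"
    if "\<xi> \<in> ell p (carrier G)"
    using B(2)[OF that] assms(2) by (simp add: left_regular_eq_conv_op ell_norm_1_delta)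
qed

lemma left_regular_delta:
  assumes "t \<in> carrier G" "r \<in> carrier G"
  shows "left_regular p G t (delta r) = delta (t \<otimes> r)"
  using assms by (simp only: left_regular_eq_conv_op conv_op_delta delta_conv_delta)

lemma left_regular_one:
  assumes "T \<in> bounded_ops p (carrier G)"
  shows "T \<circ> left_regular p G \<one> = T"
proof
  fix \<xi>
  show "(T \<circ> left_regular p G \<one>) \<xi> = T \<xi>"
  proof (cases "\<xi> \<in> ell p (carrier G)")
    case True
    then have "left_regular p G \<one> \<xi> = \<xi>"
      using ell_outside[OF True] by (auto simp: left_regular_def)
    then show ?thesis by simp
  next
    case False
    have "left_regular p G \<one> \<xi> = 0"
      using False by (auto simp: left_regular_def)
    then show ?thesis
      using bounded_opsD(1)[OF assms(1) False] bounded_ops_zero_vector[OF assms(1)] by (simp only: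
          comp_def)
  qed
qed

lemma bounded_ops_eqI:
  assumes "1 < p" "S \<in> bounded_ops p (carrier G)" "T \<in> bounded_ops p (carrier G)"
    and "\<And>r s. r \<in> carrier G \<Longrightarrow> s \<in> carrier G \<Longrightarrow> S (delta r) s = T (delta r) s"
  shows "S = T"
proof
  fix \<xi>
  show "S \<xi> = T \<xi>"
  proof (cases "\<xi> \<in> ell p (carrier G)")
    case \<xi>: True
    show ?thesis
    proof
      fix s
      show "S \<xi> s = T \<xi> s"
      proof (cases "s \<in> carrier G")
        case True
        have "((\<lambda>r. \<xi> r * S (delta r) s) has_sum T \<xi> s) (carrier G)"
          using bounded_op_has_sum[OF assms(1,3) True \<xi>] assms(4)[OF _ True]
          by (subst has_sum_cong[where g = "\<lambda>r. \<xi> r * T (delta r) s"]) auto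
        then show ?thesis
          using bounded_op_has_sum[OF assms(1,2) True \<xi>] has_sum_unique by blast
      next
        case False
        then show ?thesis
          using ell_outside bounded_opsD(2)[OF assms(2) \<xi>] bounded_opsD(2)[OF assms(3) \<xi>] by metis
      qed
    qed
  next
    case False
    then show ?thesis
      using bounded_opsD(1)[OF assms(2)] bounded_opsD(1)[OF assms(3)] by simp
  qed
qed

text \<open>\<open>delta r\<close> is the right translate of \<open>delta \<one>\<close> by \<open>inv r\<close>.\<close>

lemma CV_delta:
  assumes "T \<in> CV p G" "r \<in> carrier G" "s \<in> carrier G"
  shows "T (delta r) s = T (delta \<one>) (s \<otimes> inv r)"
proof -
  have T: "T \<in> bounded_ops p (carrier G)"
    using assms(1) by (simp add: CV_def)
  have "delta r = right_regular p G (inv r) (delta \<one>)"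
  proof
    fix s
    have "s \<otimes> inv r = \<one> \<longleftrightarrow> s = r" if "s \<in> carrier G"
      using that assms(2) inv_solve_right' by auto
    then show "delta r s = right_regular p G (inv r) (delta \<one>) s"
      using assms(2) by (auto simp: right_regular_def delta_apply)
  qed
  then have "T (delta r) = right_regular p G (inv r) (T (delta \<one>))"
  proof -
    have "T \<circ> right_regular p G (inv r) = right_regular p G (inv r) \<circ> T"
      using assms(1,2) by (simp add: CV_def)
    from fun_cong[OF this, of "delta \<one>"] \<open>delta r = _\<close> show ?thesis
      by (simp only: comp_apply)
  qed
  then show ?thesis
    using assms(3) bounded_opsD(2)[OF T, of "delta \<one>"] by (simp add: right_regular_def)
qed

text \<open>The entries of both products are sums of values of \<open>Q\<close> times values of \<open>T (delta \<one>)\<close>. The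
  substitution \<open>g = r s\<^bsup>-1\<^esup> t s\<close> turns one sum into the other, and it only conjugates the argument of
  \<open>Q\<close>.\<close>

lemma CV_commutes_class_function:
  assumes "1 < p" "T \<in> CV p G" "Q \<in> ell 1 (carrier G)" "class_function Q"
  shows "T \<circ> conv_op p Q = conv_op p Q \<circ> T"
proof (rule bounded_ops_eqI[OF assms(1)])
  have p: "0 < p" using assms(1) by simp
  have T: "T \<in> bounded_ops p (carrier G)"
    using assms(2) by (simp add: CV_def)
  note Q = conv_op_bounded(1)[OF assms(1,3)]
  show "T \<circ> conv_op p Q \<in> bounded_ops p (carrier G)" "conv_op p Q \<circ> T \<in> bounded_ops p (carrier G)"
    by (rule bounded_ops_comp[OF T Q], rule bounded_ops_comp[OF Q T])
  fix r s assume rs: "r \<in> carrier G" "s \<in> carrier G"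
  let ?\<tau> = "T (delta \<one>)"
  have r: "delta r \<in> ell p (carrier G)" using rs by simp
  have "((\<lambda>g. (Q \<star> delta r) g * T (delta g) s) has_sum T (Q \<star> delta r) s) (carrier G)"
    by (rule bounded_op_has_sum[OF assms(1) T rs(2) Young_inequality_conv(1)[OF assms(1,3) r]])
  then have "T (Q \<star> delta r) s = (\<Sum>\<^sub>\<infinity>g\<in>carrier G. (Q \<star> delta r) g * T (delta g) s)"
    by (rule infsumI[symmetric])
  also have "\<dots> = (\<Sum>\<^sub>\<infinity>g\<in>carrier G. Q (g \<otimes> inv r) * ?\<tau> (s \<otimes> inv g))"
    by (rule infsum_cong) (simp add: conv_delta[OF rs(1)] CV_delta[OF assms(2) _ rs(2)])
  also have "\<dots> = (\<Sum>\<^sub>\<infinity>t\<in>carrier G. Q (r \<otimes> inv s \<otimes> t \<otimes> s \<otimes> inv r) * ?\<tau> (s \<otimes> inv (r \<otimes> inv s \<otimes> t \<otimes> s)))"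
    by (rule infsum_reindex_bij_betw[symmetric], rule bij_betwI[where g = "\<lambda>g. s \<otimes> inv r \<otimes> g \<otimes> inv s"])
       (use rs in \<open>auto simp: m_assoc\<close>)
  also have "\<dots> = (\<Sum>\<^sub>\<infinity>t\<in>carrier G. Q t * T (delta r) (inv t \<otimes> s))"
  proof (rule infsum_cong)
    fix t assume t: "t \<in> carrier G"
    have "Q (r \<otimes> inv s \<otimes> t \<otimes> s \<otimes> inv r) = Q ((r \<otimes> inv s) \<otimes> t \<otimes> inv (r \<otimes> inv s))"
      using rs t by (simp add: m_assoc inv_mult_group)
    also have "\<dots> = Q t"
      using assms(4) rs t by (simp add: class_function_def)
    moreover have "s \<otimes> inv (r \<otimes> inv s \<otimes> t \<otimes> s) = (inv t \<otimes> s) \<otimes> inv r"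
      using rs t by (simp add: m_assoc inv_mult_group)
    ultimately show "Q (r \<otimes> inv s \<otimes> t \<otimes> s \<otimes> inv r) * ?\<tau> (s \<otimes> inv (r \<otimes> inv s \<otimes> t \<otimes> s))
        = Q t * T (delta r) (inv t \<otimes> s)"
      using CV_delta[OF assms(2) rs(1), of "inv t \<otimes> s"] rs t by simp
  qed
  also have "\<dots> = (Q \<star> T (delta r)) s"
    using rs by (simp add: convolve_def)
  finally show "(T \<circ> conv_op p Q) (delta r) s = (conv_op p Q \<circ> T) (delta r) s"
    using r bounded_opsD(2)[OF T r] by (simp add: conv_op_def)
qed

text \<open>The finite partial sums of \<open>F\<close> give linear combinations of left translations that are bounded by
  the \<open>\<ell>\<^sup>1\<close>-norm of \<open>F\<close> and converge entrywise.\<close>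

lemma conv_op_in_weakstar_closed:
  assumes "1 < p" "opvs.subspace A" "closedin (weakstar_topology p (carrier G)) A"
    and "\<And>t. t \<in> carrier G \<Longrightarrow> left_regular p G t \<in> A" and F: "F \<in> ell 1 (carrier G)"
  shows "conv_op p F \<in> A"
proof (rule limitin_closedin[OF _ assms(3)])
  have cut: "cut_off E F \<in> ell 1 (carrier G)" "ell_norm 1 (carrier G) (cut_off E F)
      \<le> ell_norm 1 (carrier G) F" for E
    using F by (auto intro!: ell_dominated[of 1 F] simp: cut_off_def ell_outside)
  show "limitin (weakstar_topology p (carrier G)) (\<lambda>E. conv_op p (cut_off E F)) (conv_op p F)
      (finite_subsets_at_top (carrier G))"
  proof (rule limitin_weakstar_bounded[OF assms(1)])
    show "conv_op p F \<in> bounded_ops p (carrier G)" "conv_op p (cut_off E F) \<in> bounded_ops p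
        (carrier G)" for E
      using conv_op_bounded(1)[OF assms(1)] F cut by auto
    show "ell_norm p (carrier G) (conv_op p (cut_off E F) \<xi>)
        \<le> ell_norm 1 (carrier G) F * ell_norm p (carrier G) \<xi>"
      if "\<xi> \<in> ell p (carrier G)" for E \<xi>
      using conv_op_bounded(2)[OF assms(1) cut(1)[of E] that] mult_right_mono[OF cut(2)[of E], of
          "ell_norm p (carrier G) \<xi>"]
      by simp
    fix r s assume rs: "r \<in> carrier G" "s \<in> carrier G"
    have "\<forall>\<^sub>F E in finite_subsets_at_top (carrier G). conv_op p (cut_off E F) (delta r) s
        = conv_op p F (delta r) s"
      unfolding eventually_finite_subsets_at_top
    proof (intro exI[of _ "{s \<otimes> inv r}"] conjI allI impI)
      show "conv_op p (cut_off E F) (delta r) s = conv_op p F (delta r) s"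
        if "finite E \<and> {s \<otimes> inv r} \<subseteq> E \<and> E \<subseteq> carrier G" for E
        using that rs by (simp add: conv_op_delta conv_delta cut_off_def)
    qed (use rs in auto)
    then show "((\<lambda>E. conv_op p (cut_off E F) (delta r) s)
        \<longlongrightarrow> conv_op p F (delta r) s) (finite_subsets_at_top (carrier G))"
      by (rule tendsto_eventually)
  qed simp
  have "conv_op p (cut_off E F) \<in> A" if "finite E" "E \<subseteq> carrier G" for E
    using that
  proof (induction E rule: finite_induct)
    case empty
    have "cut_off {} F = 0"
      by (auto simp: cut_off_def)
    then have "conv_op p (cut_off {} F) = 0"
      by (simp only: conv_op_def conv_zero_left if_cancel) (simp add: zero_fun_def)
    then show ?case
      using opvs.subspace_0[OF assms(2)] by metis
  next
    case (insert x E)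
    have x: "x \<in> carrier G" "delta x \<in> ell 1 (carrier G)"
      using insert.prems by auto
    have eq: "cut_off (insert x E) F = scale_vec (F x) (delta x) + cut_off E F"
      using insert.hyps by (auto simp: cut_off_def scale_vec_def delta_def)
    have sx: "scale_vec (F x) (delta x) \<in> ell 1 (carrier G)"
      by (rule ell_scale(1)[OF _ x(2)]) simp
    have "conv_op p (cut_off (insert x E) F) = scale_op (F x) (left_regular p G x)
        + conv_op p (cut_off E F)"
    proof
      fix \<xi>
      show "conv_op p (cut_off (insert x E) F) \<xi> = (scale_op (F x) (left_regular p G x)
          + conv_op p (cut_off E F)) \<xi>"
      proof (cases "\<xi> \<in> ell p (carrier G)")
        case True
        have "cut_off (insert x E) F \<star> \<xi> = scale_vec (F x) (delta x) \<star> \<xi> + cut_off E F \<star> \<xi>"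
          unfolding eq by (rule conv_add_left[OF sx cut(1) norm_le_ell_norm[OF _ True]])
              (use assms(1) in simp)
        then show ?thesis
          using True x by (simp add: left_regular_eq_conv_op conv_op_def scale_op_def conv_scale_left)
      next
        case False
        then show ?thesis
          by (auto simp: left_regular_def conv_op_def scale_op_def scale_vec_def)
      qed
    qed
    moreover have "scale_op (F x) (left_regular p G x) + conv_op p (cut_off E F) \<in> A"
      using insert by (intro opvs.subspace_add[OF assms(2)] opvs.subspace_scale[OF assms(2)]
          assms(4)) auto
    ultimately show ?case
      by (simp only:)
  qed
  then show "\<forall>\<^sub>F E in finite_subsets_at_top (carrier G). conv_op p (cut_off E F) \<in> A"
    by (rule eventually_finite_subsets_at_top_weakI)
qed simp

lemma left_regular_in_PM:
  assumes "1 < p" "t \<in> carrier G"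
  shows "left_regular p G t \<in> PM p G"
proof -
  have "left_regular p G t \<in> opvs.span (left_regular p G ` carrier G)"
    using assms(2) by (intro opvs.span_base) auto
  then show ?thesis
    unfolding PM_def in_closure_of using left_regular_bounded(1)[OF assms] by auto
qed

section \<open>Weak*-simplicity and the ICC property\<close>

text \<open>The witness is the ideal of all \<open>T\<close> in \<open>A\<close> annihilated by the convolution with \<open>Q\<close>. It is
  weak*-closed because each value \<open>(Q \<star> T \<xi>) s\<close> is a pairing of \<open>T \<xi>\<close> with a vector in \<open>\<ell>\<^sup>1(G)\<close>.\<close>

theorem not_weakstar_simple_if_not_ICC:
  assumes "1 < p" and A: "subalgebra p (carrier G) A" "closedin (weakstar_topology p (carrier G)) A"
    "PM p G \<subseteq> A" "A \<subseteq> CV p G" and "\<not> ICC G"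
  shows "\<not> weakstar_simple p (carrier G) A"
proof -
  have p: "0 < p" using assms(1) by simp
  obtain Q F where QF: "Q \<in> ell 1 (carrier G)" "F \<in> ell 1 (carrier G)" "class_function Q"
      "Q \<noteq> 0" "F \<noteq> 0" "Q \<star> F = 0"
    using zero_divisor_if_not_ICC[OF assms(6)] by blast
  have sub: "opvs.subspace A" and A_bounded: "\<And>T. T \<in> A \<Longrightarrow> T \<in> bounded_ops p (carrier G)"
    and A_comp: "\<And>S T. S \<in> A \<Longrightarrow> T \<in> A \<Longrightarrow> S \<circ> T \<in> A"
    using A(1) by (auto simp: subalgebra_def)
  have reg: "left_regular p G t \<in> A" if "t \<in> carrier G" for t
    using left_regular_in_PM[OF assms(1) that] A(3) by blast
  define J where "J = {T \<in> A. \<forall>\<xi>\<in>ell p (carrier G). Q \<star> T \<xi> = 0}"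
  have JI: "T \<in> J" if "T \<in> A" "\<And>\<xi>. \<xi> \<in> ell p (carrier G) \<Longrightarrow> Q \<star> T \<xi> = 0" for T
    using that unfolding J_def by blast
  have JD: "T \<in> A" "\<And>\<xi>. \<xi> \<in> ell p (carrier G) \<Longrightarrow> Q \<star> T \<xi> = 0" if "T \<in> J" for T
    using that unfolding J_def by blast+
  have range: "T \<xi> \<in> ell p (carrier G)" if "T \<in> A" "\<xi> \<in> ell p (carrier G)" for T \<xi>
    by (rule bounded_opsD(2)[OF A_bounded[OF that(1)] that(2)])
  have ideal: "alg_ideal A J"
    unfolding alg_ideal_def
  proof (intro conjI ballI)
    show "J \<subseteq> A" using JD by blast
    show "opvs.subspace J"
    proof (rule opvs.subspaceI)
      show "0 \<in> J"
        by (rule JI[OF opvs.subspace_0[OF sub]]) (simp only: zero_fun_apply conv_zero_right)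
      show "S + T \<in> J" if "S \<in> J" "T \<in> J" for S T
      proof (rule JI[OF opvs.subspace_add[OF sub JD(1)[OF that(1)] JD(1)[OF that(2)]]])
        fix \<xi> assume \<xi>: "\<xi> \<in> ell p (carrier G)"
        have "Q \<star> (S \<xi> + T \<xi>) = Q \<star> S \<xi> + Q \<star> T \<xi>"
          by (rule conv_add_right[OF QF(1) norm_le_ell_norm[OF p range[OF JD(1)[OF that(1)] \<xi>]]
                norm_le_ell_norm[OF p range[OF JD(1)[OF that(2)] \<xi>]]])
        then show "Q \<star> (S + T) \<xi> = 0"
          by (simp only: plus_fun_apply JD(2)[OF that(1) \<xi>] JD(2)[OF that(2) \<xi>] add_0)
      qed
      show "scale_op c T \<in> J" if "T \<in> J" for c T
      proof (rule JI[OF opvs.subspace_scale[OF sub JD(1)[OF that]]])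
        fix \<xi> assume \<xi>: "\<xi> \<in> ell p (carrier G)"
        show "Q \<star> scale_op c T \<xi> = 0"
          unfolding scale_op_def conv_scale_right JD(2)[OF that \<xi>] by (auto simp: scale_vec_def)
      qed
    qed
    fix S T assume S: "S \<in> A" and T: "T \<in> J"
    have "S \<in> CV p G" using S A(4) by blast
    note comm = CV_commutes_class_function[OF assms(1) this QF(1,3)]
    show "S \<circ> T \<in> J"
    proof (rule JI[OF A_comp[OF S JD(1)[OF T]]])
      fix \<xi> assume \<xi>: "\<xi> \<in> ell p (carrier G)"
      note T\<xi> = range[OF JD(1)[OF T] \<xi>]
      have "Q \<star> S (T \<xi>) = S (Q \<star> T \<xi>)"
        using fun_cong[OF comm, of "T \<xi>"] T\<xi> range[OF S T\<xi>] by (simp add: conv_op_def)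
      also have "\<dots> = 0"
        by (simp only: JD(2)[OF T \<xi>] bounded_ops_zero_vector[OF A_bounded[OF S]])
      finally show "Q \<star> (S \<circ> T) \<xi> = 0"
        by (simp only: comp_apply)
    qed
    show "T \<circ> S \<in> J"
      by (rule JI[OF A_comp[OF JD(1)[OF T] S]]) (simp only: comp_apply JD(2)[OF T] range[OF S])
  qed
  have closed: "closedin (subtopology (weakstar_topology p (carrier G)) A) J"
  proof -
    \<comment> \<open>The vector that represents the functional \<open>\<zeta> \<mapsto> (Q \<star> \<zeta>) s\<close>\<close>
    define \<eta> where "\<eta> s = (\<lambda>r. if r \<in> carrier G then Q (s \<otimes> inv r) else 0)" for s
    have \<eta>: "\<eta> s \<in> ell (conj_exponent p) (carrier G)" if s: "s \<in> carrier G" for s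
    proof -
      have "bij_betw (\<lambda>r. s \<otimes> inv r) (carrier G) (carrier G)"
        by (rule bij_betwI[where g = "\<lambda>t. inv t \<otimes> s"]) (use s in \<open>auto
            simp: inv_mult_group m_assoc[symmetric]\<close>, simp add: m_assoc)
      then have "(\<lambda>r. norm (Q (s \<otimes> inv r))) summable_on carrier G"
        using QF(1) summable_on_reindex_bij_betw[of _ _ _ "\<lambda>t. norm (Q t)"] by (auto simp: ell_1_iff)
      then have "(\<lambda>r. norm (\<eta> s r)) summable_on carrier G"
        by (rule summable_on_cong[THEN iffD1, rotated]) (simp add: \<eta>_def)
      then have "\<eta> s \<in> ell 1 (carrier G)"
        by (simp add: ell_1_iff \<eta>_def)
      then show ?thesis
        by (rule ell_1_subset_ell[rotated]) (use conj_exponent_gt_1[OF assms(1)] in simp)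
    qed
    have pairing: "ell_pairing (carrier G) (\<eta> s) \<zeta> = (Q \<star> \<zeta>) s" if "s \<in> carrier G" for s \<zeta>
      unfolding ell_pairing_def conv_right_kernel[OF that] by (rule infsum_cong) (simp add: \<eta>_def)
    let ?K = "\<Inter>(\<xi>, s)\<in>ell p (carrier G) \<times> carrier G.
      {T \<in> bounded_ops p (carrier G). ell_pairing (carrier G) (\<eta> s) (T \<xi>) = 0}"
    have "closedin (weakstar_topology p (carrier G)) ?K"
    proof (rule closedin_INT)
      show "ell p (carrier G) \<times> carrier G \<noteq> {}"
        using ell_zero[of p "carrier G"] by blast
      show "closedin (weakstar_topology p (carrier G))
          (case z of (\<xi>, s) \<Rightarrow> {T \<in> bounded_ops p (carrier G). ell_pairing (carrier G) (\<eta> s) (T \<xi>) = 0})"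
        if "z \<in> ell p (carrier G) \<times> carrier G" for z
        using that \<eta> by (auto intro!: closedin_weakstar_annihilator)
    qed
    moreover have "J = ?K \<inter> A"
    proof (intro equalityI subsetI)
      fix T assume T: "T \<in> J"
      have "ell_pairing (carrier G) (\<eta> s) (T \<xi>) = 0" if "s \<in> carrier G" "\<xi> \<in> ell p (carrier G)" for s \<xi>
        unfolding pairing[OF that(1)] JD(2)[OF T that(2)] by simp
      then show "T \<in> ?K \<inter> A"
        using JD(1)[OF T] A_bounded by auto
    next
      fix T assume T: "T \<in> ?K \<inter> A"
      show "T \<in> J"
      proof (rule JI)
        fix \<xi> assume \<xi>: "\<xi> \<in> ell p (carrier G)"
        show "Q \<star> T \<xi> = 0"
        proof
          fix s
          show "(Q \<star> T \<xi>) s = 0 s"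
          proof (cases "s \<in> carrier G")
            case True
            then have "ell_pairing (carrier G) (\<eta> s) (T \<xi>) = 0"
              using T \<xi> by blast
            then show ?thesis
              unfolding pairing[OF True] by simp
          qed (simp add: convolve_def)
        qed
      qed (use T in blast)
    qed
    ultimately show ?thesis
      unfolding closedin_subtopology by blast
  qed
  have F: "conv_op p F \<in> J"
  proof (rule JI[OF conv_op_in_weakstar_closed[OF assms(1) sub A(2) reg QF(2)]])
    fix \<xi> assume \<xi>: "\<xi> \<in> ell p (carrier G)"
    have "Q \<star> (F \<star> \<xi>) = (Q \<star> F) \<star> \<xi>"
      by (rule conv_assoc[symmetric, OF QF(1,2) norm_le_ell_norm[OF p \<xi>]])
    then show "Q \<star> conv_op p F \<xi> = 0"
      using \<xi> by (simp only: conv_op_def QF(6) conv_zero_left if_True)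
  qed
  have "conv_op p F (delta \<one>) = F"
    unfolding conv_op_delta[OF one_closed] by (rule conv_delta_one[OF ell_outside[OF QF(2)]])
  then have "conv_op p F \<noteq> 0"
    using QF(5) by (metis zero_fun_apply)
  then have "J \<noteq> {0}"
    using F by blast
  moreover have "J \<noteq> A"
  proof
    assume "J = A"
    then have "left_regular p G \<one> \<in> J"
      using reg by simp
    then have "Q \<star> left_regular p G \<one> (delta \<one>) = 0"
      by (rule JD(2)) simp
    moreover have "left_regular p G \<one> (delta \<one>) = delta \<one>"
      using left_regular_delta[of \<one> \<one>] by simp
    moreover have "Q \<star> delta \<one> = Q"
      by (rule conv_delta_one[OF ell_outside[OF QF(1)]])
    ultimately show False
      using QF(4) by metis
  qed
  ultimately show ?thesis
    using ideal closed unfolding weakstar_simple_def by blast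
qed

text \<open>A nonzero weak*-closed ideal contains a net of conjugates of one operator that converges to the
  identity.\<close>

theorem weakstar_simple_if_ICC:
  assumes "1 < p" and A: "subalgebra p (carrier G) A" "closedin (weakstar_topology p (carrier G)) A"
    "PM p G \<subseteq> A" "A \<subseteq> CV p G" and "ICC G"
  shows "weakstar_simple p (carrier G) A"
  unfolding weakstar_simple_def
proof (rule notI, elim exE conjE)
  fix J assume J: "alg_ideal A J" "closedin (subtopology (weakstar_topology p (carrier G)) A) J"
      "J \<noteq> {0}" "J \<noteq> A"
  have p: "0 < p" using assms(1) by simp
  have sub: "opvs.subspace J" and JA: "J \<subseteq> A"
    and J_comp: "\<And>S T. S \<in> A \<Longrightarrow> T \<in> J \<Longrightarrow> S \<circ> T \<in> J" "\<And>S T. S \<in> J \<Longrightarrow> T \<in> A \<Longrightarrow> S \<circ> T \<in> J"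
    using J(1) by (auto simp: alg_ideal_def)
  have A_bounded: "T \<in> bounded_ops p (carrier G)" if "T \<in> A" for T
    using A(1) that by (auto simp: subalgebra_def)
  have reg: "left_regular p G t \<in> A" if "t \<in> carrier G" for t
    using left_regular_in_PM[OF assms(1) that] A(3) by blast
  obtain T where T: "T \<in> J" "T \<noteq> 0"
    using J(3) opvs.subspace_0[OF sub] by blast
  have "\<exists>r\<in>carrier G. \<exists>s\<in>carrier G. T (delta r) s \<noteq> 0"
  proof (rule ccontr)
    assume "\<not> ?thesis"
    then have "T = 0"
      using A_bounded T(1) JA by (intro bounded_ops_eqI[OF assms(1) _ zero_in_bounded_ops]) auto
    then show False using T(2) by blast
  qed
  then obtain r s where rs: "r \<in> carrier G" "s \<in> carrier G" "T (delta r) s \<noteq> 0" by blast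
  \<comment> \<open>The translation by \<open>r s\<^bsup>-1\<^esup>\<close> moves the nonzero entry \<open>(s, r)\<close> of \<open>T\<close> to the diagonal.\<close>
  define S where "S = scale_op (1 / T (delta r) s) (left_regular p G (r \<otimes> inv s) \<circ> T)"
  have SJ: "S \<in> J"
    unfolding S_def using rs T(1) by (intro opvs.subspace_scale[OF sub] J_comp reg) auto
  have SCV: "S \<in> CV p G" and SB: "S \<in> bounded_ops p (carrier G)"
    using SJ JA A(4) A_bounded by blast+
  let ?\<tau> = "S (delta \<one>)"
  have \<tau>_one: "?\<tau> \<one> = 1"
  proof -
    have "T (delta r) \<in> ell p (carrier G)"
      using bounded_opsD(2)[OF A_bounded] T(1) JA rs(1) by auto
    then have "S (delta r) r = 1"
      using rs by (simp add: S_def scale_op_def scale_vec_def left_regular_def inv_mult_group m_assoc)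
    then show ?thesis
      using CV_delta[OF SCV rs(1) rs(1)] rs by simp
  qed
  define U where "U t = left_regular p G t \<circ> (S \<circ> left_regular p G (inv t))" for t
  have UJ: "U t \<in> J" if "t \<in> carrier G" for t
    unfolding U_def using that SJ by (intro J_comp reg) auto
  have U_delta: "U t (delta r) s = ?\<tau> (inv t \<otimes> (s \<otimes> inv r) \<otimes> t)"
    if "t \<in> carrier G" "r \<in> carrier G" "s \<in> carrier G" for t r s
  proof -
    have "S (delta (inv t \<otimes> r)) \<in> ell p (carrier G)"
      using that by (intro bounded_opsD(2)[OF SB]) simp
    then have "U t (delta r) s = S (delta (inv t \<otimes> r)) (inv t \<otimes> s)"
      unfolding U_def comp_apply left_regular_delta[OF inv_closed[OF that(1)] that(2)]
      using that by (simp add: left_regular_def)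
    also have "\<dots> = ?\<tau> (inv t \<otimes> s \<otimes> inv (inv t \<otimes> r))"
      by (rule CV_delta[OF SCV]) (use that in auto)
    also have "inv t \<otimes> s \<otimes> inv (inv t \<otimes> r) = inv t \<otimes> (s \<otimes> inv r) \<otimes> t"
      using that by (simp add: inv_mult_group m_assoc)
    finally show ?thesis .
  qed
  have "\<exists>t\<in>carrier G. finite E \<and> E \<subseteq> carrier G \<longrightarrow> (\<forall>g\<in>E - {\<one>}. inv t \<otimes> g \<otimes> t \<notin> E)" for E
  proof (cases "finite E \<and> E \<subseteq> carrier G")
    case True
    then show ?thesis
      using ICC_escape[OF assms(6), of "E - {\<one>}" E] by auto
  qed (use one_closed in blast)
  then obtain \<theta> where \<theta>: "\<And>E. \<theta> E \<in> carrier G"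
      "\<And>E g. finite E \<Longrightarrow> E \<subseteq> carrier G \<Longrightarrow> g \<in> E - {\<one>} \<Longrightarrow> inv (\<theta> E) \<otimes> g \<otimes> \<theta> E \<notin> E"
    by metis
  obtain C where C: "0 \<le> C" "\<And>\<xi>. \<xi> \<in> ell p (carrier G) \<Longrightarrow> ell_norm p (carrier G) (S \<xi>)
      \<le> C * ell_norm p (carrier G) \<xi>"
    using bounded_ops_bound[OF SB] by blast
  have "limitin (weakstar_topology p (carrier G)) (\<lambda>E. U (\<theta> E)) (left_regular p G \<one>)
      (finite_subsets_at_top (carrier G))"
  proof (rule limitin_weakstar_bounded[OF assms(1)])
    show "left_regular p G \<one> \<in> bounded_ops p (carrier G)"
      by (rule left_regular_bounded(1)[OF assms(1) one_closed])
    show "U (\<theta> E) \<in> bounded_ops p (carrier G)" for E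
      using UJ[OF \<theta>(1)] JA A_bounded by blast
    show "ell_norm p (carrier G) (U (\<theta> E) \<xi>) \<le> C * ell_norm p (carrier G) \<xi>"
      if \<xi>: "\<xi> \<in> ell p (carrier G)" for E \<xi>
    proof -
      let ?\<zeta> = "left_regular p G (inv (\<theta> E)) \<xi>"
      have \<zeta>: "?\<zeta> \<in> ell p (carrier G)" "ell_norm p (carrier G) ?\<zeta> \<le> ell_norm p (carrier G) \<xi>"
        using left_regular_bounded[OF assms(1) inv_closed[OF \<theta>(1)]] \<xi> by (auto intro: bounded_opsD(2))
      have "ell_norm p (carrier G) (U (\<theta> E) \<xi>) \<le> ell_norm p (carrier G) (S ?\<zeta>)"
        unfolding U_def comp_apply
        by (rule left_regular_bounded(2)[OF assms(1) \<theta>(1) bounded_opsD(2)[OF SB \<zeta>(1)]])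
      also have "\<dots> \<le> C * ell_norm p (carrier G) ?\<zeta>"
        by (rule C(2)[OF \<zeta>(1)])
      also have "\<dots> \<le> C * ell_norm p (carrier G) \<xi>"
        by (rule mult_left_mono[OF \<zeta>(2) C(1)])
      finally show ?thesis .
    qed
    fix r s assume rs: "r \<in> carrier G" "s \<in> carrier G"
    define g where "g = s \<otimes> inv r"
    have g: "g \<in> carrier G" "g = \<one> \<longleftrightarrow> s = r"
      using rs inv_solve_right' by (auto simp: g_def)
    have U_g: "U (\<theta> E) (delta r) s = ?\<tau> (inv (\<theta> E) \<otimes> g \<otimes> \<theta> E)" for E
      unfolding g_def by (rule U_delta[OF \<theta>(1) rs])
    have lim: "left_regular p G \<one> (delta r) s = (if g = \<one> then 1 else 0)"
      using left_regular_delta[OF one_closed rs(1)] rs g(2) by (simp add: delta_def)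
    have "((\<lambda>E. ?\<tau> (inv (\<theta> E) \<otimes> g \<otimes> \<theta> E)) \<longlongrightarrow> (if g = \<one> then 1 else 0)) (finite_subsets_at_top
        (carrier G))"
    proof (cases "g = \<one>")
      case True
      then show ?thesis
        using \<theta>(1) \<tau>_one by simp
    next
      case False
      have "((\<lambda>E. ?\<tau> (inv (\<theta> E) \<otimes> g \<otimes> \<theta> E)) \<longlongrightarrow> 0) (finite_subsets_at_top (carrier G))"
      proof (rule tendstoI)
        fix e :: real assume "0 < e"
        \<comment> \<open>Once \<open>E\<close> contains \<open>g\<close> and all points where the symbol is large, \<open>g\<close> is conjugated out
            of \<open>E\<close>.\<close>
        let ?B = "{h \<in> carrier G. e \<le> norm (?\<tau> h)}"
        have "finite ?B"
          using bounded_opsD(2)[OF SB] p \<open>0 < e\<close> by (intro ell_finite_superlevel) auto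
        then show "\<forall>\<^sub>F E in finite_subsets_at_top (carrier G). dist (?\<tau> (inv (\<theta> E) \<otimes> g \<otimes> \<theta> E)) 0 < e"
          unfolding eventually_finite_subsets_at_top
        proof (intro exI[of _ "insert g ?B"] conjI allI impI)
          fix E assume E: "finite E \<and> insert g ?B \<subseteq> E \<and> E \<subseteq> carrier G"
          then have "inv (\<theta> E) \<otimes> g \<otimes> \<theta> E \<notin> E"
            using False by (intro \<theta>(2)) auto
          then have "inv (\<theta> E) \<otimes> g \<otimes> \<theta> E \<notin> ?B"
            using E by blast
          then show "dist (?\<tau> (inv (\<theta> E) \<otimes> g \<otimes> \<theta> E)) 0 < e"
            using \<theta>(1)[of E] g(1) by simp
        qed (use g in auto)
      qed
      then show ?thesis using False by simp
    qed
    then show "((\<lambda>E. U (\<theta> E) (delta r) s) \<longlongrightarrow> left_regular p G \<one> (delta r) s) (finite_subsets_at_top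
        (carrier G))"
      unfolding U_g lim .
  qed simp
  moreover have "closedin (weakstar_topology p (carrier G)) J"
    by (rule closedin_trans_full[OF J(2) A(2)])
  ultimately have "left_regular p G \<one> \<in> J"
    by (rule limitin_closedin) (use UJ[OF \<theta>(1)] in auto)
  then have "R \<in> J" if "R \<in> A" for R
    using J_comp(1)[OF that] left_regular_one[OF A_bounded[OF that]] by metis
  then show False
    using J(4) JA by blast
qed

end

theorem theorem3p5:
  fixes G :: "('a, 'b) monoid_scheme" and p :: real and A :: "'a operator set"
  assumes "group G"
    and "1 < p"
    and "subalgebra p (carrier G) A"
    and "closedin (weakstar_topology p (carrier G)) A"
    and "PM p G \<subseteq> A" and "A \<subseteq> CV p G"
  shows "weakstar_simple p (carrier G) A \<longleftrightarrow> ICC G"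
  using group.weakstar_simple_if_ICC[OF assms(1-6)] group.not_weakstar_simple_if_not_ICC[OF assms(1-6)]
  by blast

end
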